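(* Let $n\ge4$. Then $\sqrt F=\{d\in D\mid d^2\in F\}$ is a subgroup of $D$ with the following properties. 1. The quotient group $$\sqrt F/F=\langle d_1^{2^{n-3}}F\rangle\times\prod_{k=1}^{n-3}\ \prod_{2l+1\in A_k}\langle q(k,2l+1)^{2^{k-1}}F\rangle$$ (internal direct product), and it is an elementary abelian $2$-group, possibly trivial. 2. $D^{2^{n-2}}<F\le\sqrt F\cap E\le\sqrt F<D$, where $<$ denotes a proper subgroup.
   Context: Let $\alpha=e^{2\pi i/2^n}$. For $\rho,\sigma\in\mathbf{Z}[\alpha]$, $\rho\equiv\sigma\pmod 2$ means $\rho-\sigma\in 2\mathbf{Z}[\alpha]$. For an integer $j$ put $d_j=1+\alpha^j+\alpha^{-j}$. Let $D$ be the subgroup of the unit group of $\mathbf{Z}[\alpha]$ generated by $d_1,d_3,\dots,d_{2^{n-1}-3}$ (it is the internal direct product of the infinite cyclic groups $\langle d_{2l+1}\rangle$, $0\le l\le 2^{n-2}-2$), and let $D^m=\{d^m\mid d\in D\}$. Put $E=\{\lambda\in D\mid \lambda\equiv 1\pmod 2\}$. For $k\in\{0,1,\dots,n-3\}$ let $A_k=\{1,3,5,\dots,2^{n-2-k}-1\}$ (all odd integers from $1$ to $2^{n-2-k}-1$). For $2l+1\in A_0\setminus\{1\}$ (when $k=0$) or $2l+1\in A_k$ (when $1\le k\le n-3$) put $q(k,2l+1)=d_{2l+1}^{-1}d_{2^{n-1-k}-(2l+1)}$. Put $F_0=\prod_{2l+1\in A_0\setminus\{1\}}\langle q(0,2l+1)\rangle$,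 $F_k=\prod_{2l+1\in A_k}\langle q(k,2l+1)^{2^k}\rangle$ for $1\le k\le n-3$, and $F=\langle d_1^{2^{n-2}}\rangle\times\prod_{k=0}^{n-3}F_k$ (internal direct products). *)

theory Defs
  imports
    "HOL-Algebra.Multiplicative_Group"
    "HOL-Computational_Algebra.Polynomial"
    "HOL-Analysis.Complex_Transcendental"
begin

subsection \<open>Group-theoretic notions\<close>

text \<open>The internal (restricted) direct product of a family of subgroups. Indexing by an arbitrary
  set means that equal members of the family at different indices are not identified.\<close>

definition internal_direct_product :: "('a, 'b) monoid_scheme \<Rightarrow> 'i set \<Rightarrow> ('i \<Rightarrow> 'a set) \<Rightarrow> bool"
  where "internal_direct_product G I H \<longleftrightarrow>
    (\<forall>i\<in>I. H i \<lhd> G) \<and>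
    carrier G = generate G (\<Union>i\<in>I. H i) \<and>
    (\<forall>i\<in>I. H i \<inter> generate G (\<Union>j\<in>I - {i}. H j) = {\<one>\<^bsub>G\<^esub>})"

definition elementary_abelian :: "nat \<Rightarrow> ('a, 'b) monoid_scheme \<Rightarrow> bool"
  where "elementary_abelian p G \<longleftrightarrow>
    comm_group G \<and> (\<forall>x\<in>carrier G. x \<noteq> \<one>\<^bsub>G\<^esub> \<longrightarrow> group.ord G x = p)"

definition proper_subgroup :: "'a set \<Rightarrow> ('a, 'b) monoid_scheme \<Rightarrow> bool"
  where "proper_subgroup H G \<longleftrightarrow> subgroup H G \<and> H \<noteq> carrier G"

subsection \<open>The cyclotomic ring and its unit group\<close>

definition alpha :: "nat \<Rightarrow> complex"
  where "alpha n = exp (2 * of_real pi * \<i> / 2 ^ n)"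

definition Z_alpha :: "nat \<Rightarrow> complex set"
  where "Z_alpha n = range (\<lambda>p::int poly. poly (map_poly of_int p) (alpha n))"

definition cyc_ring :: "nat \<Rightarrow> complex ring"
  where "cyc_ring n =
    \<lparr>carrier = Z_alpha n, monoid.mult = (*), one = 1, ring.zero = 0, add = (+)\<rparr>"

abbreviation U :: "nat \<Rightarrow> complex monoid"
  where "U n \<equiv> units_of (cyc_ring n)"

text \<open>A subset \<open>H\<close> of the unit group, with the operations of the unit group.\<close>

abbreviation grp :: "nat \<Rightarrow> complex set \<Rightarrow> complex monoid"
  where "grp n H \<equiv> (U n)\<lparr>carrier := H\<rparr>"

definition cong2 :: "nat \<Rightarrow> complex \<Rightarrow> complex \<Rightarrow> bool"
  where "cong2 n \<rho> \<sigma> \<longleftrightarrow> \<rho> - \<sigma> \<in> {2 * z | z. z \<in> Z_alpha n}"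

subsection \<open>The groups of units\<close>

definition d :: "nat \<Rightarrow> int \<Rightarrow> complex"
  where "d n j = 1 + alpha n powi j + alpha n powi (- j)"

definition D :: "nat \<Rightarrow> complex set"
  where "D n = generate (U n) {d n j | j. odd j \<and> 1 \<le> j \<and> j \<le> 2 ^ (n - 1) - 3}"

definition D_pow :: "nat \<Rightarrow> nat \<Rightarrow> complex set"
  where "D_pow n m = {x [^]\<^bsub>U n\<^esub> m | x. x \<in> D n}"

definition E :: "nat \<Rightarrow> complex set"
  where "E n = {x \<in> D n. cong2 n x 1}"

definition A :: "nat \<Rightarrow> nat \<Rightarrow> int set"
  where "A n k = {j. odd j \<and> 1 \<le> j \<and> j \<le> 2 ^ (n - 2 - k) - 1}"

definition q :: "nat \<Rightarrow> nat \<Rightarrow> int \<Rightarrow> complex"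
  where "q n k j = inv\<^bsub>U n\<^esub> (d n j) \<otimes>\<^bsub>U n\<^esub> d n (2 ^ (n - 1 - k) - j)"

text \<open>In the abelian group of units, the product of a family of subgroups is the subgroup
  generated by their union. (For \<open>k = 0\<close> the exponent \<open>2 ^ k\<close> is \<open>1\<close>.)\<close>

definition F_part :: "nat \<Rightarrow> nat \<Rightarrow> complex set"
  where "F_part n k = generate (U n)
    (\<Union>j \<in> (if k = 0 then A n 0 - {1} else A n k). generate (U n) {q n k j [^]\<^bsub>U n\<^esub> (2 ^ k :: nat)})"

definition F :: "nat \<Rightarrow> complex set"
  where "F n = generate (U n)
    (generate (U n) {d n 1 [^]\<^bsub>U n\<^esub> (2 ^ (n - 2) :: nat)} \<union> (\<Union>k\<in>{0..n - 3}. F_part n k))"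

definition sqrt_F :: "nat \<Rightarrow> complex set"
  where "sqrt_F n = {x \<in> D n. x [^]\<^bsub>U n\<^esub> (2::nat) \<in> F n}"

definition Q :: "nat \<Rightarrow> complex set monoid"
  where "Q n = grp n (sqrt_F n) Mod F n"

definition coset :: "nat \<Rightarrow> complex \<Rightarrow> complex set"
  where "coset n x = F n #>\<^bsub>grp n (sqrt_F n)\<^esub> x"

text \<open>The cyclic factors of the quotient: \<open>None\<close> indexes the one generated by the coset of a
  power of \<open>d n 1\<close>, and \<open>Some (k, j)\<close> the one coming from \<open>q n k j\<close>.\<close>

definition Q_index :: "nat \<Rightarrow> (nat \<times> int) option set"
  where "Q_index n = insert None (Some ` (SIGMA k:{1..n - 3}. A n k))"

definition Q_factor :: "nat \<Rightarrow> (nat \<times> int) option \<Rightarrow> complex set set"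
  where "Q_factor n i = (case i of
      None \<Rightarrow> generate (Q n) {coset n (d n 1 [^]\<^bsub>U n\<^esub> (2 ^ (n - 3) :: nat))}
    | Some (k, j) \<Rightarrow> generate (Q n) {coset n (q n k j [^]\<^bsub>U n\<^esub> (2 ^ (k - 1) :: nat))})"

end

theory Submission
  imports
    Defs
    "HOL-Computational_Algebra.Polynomial_Factorial"
    "HOL-Number_Theory.Cong"
begin

text \<open>
  Everything reduces to one fact: \<open>D\<close> is a free abelian group that has a basis adapted to \<open>F\<close>.
  Such a basis consists of \<open>d\<^sub>1\<close> and all the quotients \<open>q(k,j)\<close>. The element \<open>q(k,j)\<close> is
  \<open>d\<^sub>m\<close> with \<open>m = 2^(n-1-k) - j\<close>, divided by \<open>d\<^sub>j\<close>, where \<open>j < 2^(n-2-k) < m\<close>. Every odd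
  \<open>m\<close> with \<open>1 < m < 2^(n-1) - 1\<close> lies strictly between two consecutive powers of two and so
  arises from exactly one pair \<open>(k,j)\<close>; hence the passage from the \<open>d\<^sub>m\<close> to the new elements is
  unitriangular, and it preserves both generation (\<open>D_eq_basis\<close>) and independence
  (\<open>mult_independent_unitriangular\<close>). In coordinates \<open>F\<close> consists of the exponent vectors
  divisible by \<open>2^(n-2)\<close> at \<open>d\<^sub>1\<close> and by \<open>2^k\<close> at \<open>q(k,j)\<close>. So a square lies in \<open>F\<close> iff
  the exponents are divisible by half of these numbers (by \<open>1\<close> where the number is \<open>1\<close>), the
  quotient is a product of groups of order two, and all inclusions and non-equalities can be read
  off from the coordinates. This is the content of the locale \<open>free_basis\<close>. The inclusion of
  \<open>F\<close> in \<open>E\<close> is a separate computation modulo \<open>2\<close> (\<open>cong2_F_generator\<close>): squaring sends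
  \<open>d\<^sub>j\<close> to \<open>d\<^sub>2\<^sub>j\<close> up to a multiple of \<open>2\<close>.

  The independence of the \<open>d\<^sub>j\<close> (\<open>d_multiplicatively_independent\<close>) is where arithmetic enters.
  Usually it follows from the non-vanishing of \<open>L(1,\<chi>)\<close>; for 2-power roots of unity an
  elementary argument is enough. A relation among the real numbers \<open>d\<^sub>j\<close> may be conjugated by
  any \<open>\<alpha> \<mapsto> \<alpha>^t\<close>, \<open>t\<close> odd, since \<open>x^(2^(n-1)) + 1\<close> is irreducible. Up to sign the
  odd residues modulo \<open>2^n\<close> are the powers of \<open>3\<close>, so a relation is an integer polynomial \<open>p\<close>
  whose pairing with the sequence \<open>log |d(3^i)|\<close> vanishes, and conjugation says that such \<open>p\<close>
  form an ideal. This ideal contains \<open>x^N - 1\<close> with \<open>N = 2^(n-2)\<close>, and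
  \<open>(x^N - 1)/(x - 1)\<close> is the product of the irreducible polynomials \<open>x^(2^s) + 1\<close>,
  \<open>s < n-2\<close>. If one of these did not divide \<open>p\<close>, then by Bezout a nonzero integer multiple of
  the complementary factor of \<open>x^N - 1\<close> would be a relation. But by norm compatibility the
  complementary factor pairs to \<open>log |1 - 2 cos \<theta>| - log |1 + 2 cos \<theta>|\<close> with
  \<open>\<theta> = 2\<pi> / 2^(s+3)\<close>, which is not zero. Hence \<open>p\<close> is divisible by all of them and, having
  degree less than \<open>N\<close>, is a multiple of \<open>1 + x + ... + x^(N-1)\<close>. As the unit with the index
  \<open>2^(n-1) - 1\<close> does not occur in the relation, \<open>p = 0\<close>.
\<close>

section \<open>Irreducibility of the 2-power cyclotomic polynomials\<close>

text \<open>
  If \<open>f = g h\<close>, then \<open>p\<close> divides the constant coefficient of one factor, say \<open>g\<close>, but not that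
  of \<open>h\<close>. The lowest coefficient of \<open>g\<close> prime to \<open>p\<close> then yields a coefficient of \<open>f\<close> prime
  to \<open>p\<close> in the same degree, which must be the degree of \<open>f\<close>; so \<open>h\<close> is constant.
\<close>

lemma eisenstein_monic:
  fixes f :: "int poly" and p :: int
  assumes p: "prime p" and monic: "lead_coeff f = 1" and deg: "degree f > 0"
    and low: "\<And>i. i < degree f \<Longrightarrow> p dvd Polynomial.coeff f i"
    and const: "\<not> p ^ 2 dvd Polynomial.coeff f 0"
  shows "irreducible f"
proof -
  have f0: "f \<noteq> 0" using monic by auto
  have key: "degree g = degree f"
    if gh: "f = g * h" and p0: "p dvd Polynomial.coeff g 0" for g h :: "int poly"
  proof -
    have nh: "\<not> p dvd Polynomial.coeff h 0"
      using const p0 unfolding gh by (auto simp: Polynomial.coeff_mult power2_eq_square intro: mult_dvd_mono)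
    have "lead_coeff g * lead_coeff h = 1" using monic gh by (simp add: lead_coeff_mult)
    hence "\<not> p dvd lead_coeff g"
      using p by (metis dvd_mult2 not_prime_unit)
    hence ex: "\<exists>i. \<not> p dvd Polynomial.coeff g i" by blast
    define i where "i = (LEAST i. \<not> p dvd Polynomial.coeff g i)"
    have i: "\<not> p dvd Polynomial.coeff g i" unfolding i_def by (rule LeastI_ex[OF ex])
    have lt: "p dvd Polynomial.coeff g j" if "j < i" for j
      using not_less_Least that unfolding i_def by blast
    have "Polynomial.coeff f i = (\<Sum>j\<le>i. Polynomial.coeff g j * Polynomial.coeff h (i - j))"
      unfolding gh by (rule Polynomial.coeff_mult)
    also have "\<dots> = (\<Sum>j<i. Polynomial.coeff g j * Polynomial.coeff h (i - j))
        + Polynomial.coeff g i * Polynomial.coeff h 0"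
      by (simp add: lessThan_Suc_atMost[symmetric])
    finally have eq: "Polynomial.coeff f i = \<dots>" .
    have "p dvd (\<Sum>j<i. Polynomial.coeff g j * Polynomial.coeff h (i - j))"
      by (intro dvd_sum dvd_mult2 lt) auto
    moreover have "\<not> p dvd Polynomial.coeff g i * Polynomial.coeff h 0"
      using i nh p by (simp add: prime_dvd_mult_iff)
    ultimately have "\<not> p dvd Polynomial.coeff f i" unfolding eq by (simp add: dvd_add_right_iff)
    hence "i \<ge> degree f" using low not_less by blast
    moreover have "i \<le> degree g" using i by (metis dvd_0_right Polynomial.le_degree)
    moreover have "degree g \<le> degree f" unfolding gh using f0 gh
      by (metis Polynomial.dvd_imp_degree_le dvd_triv_left)
    ultimately show ?thesis by linarith
  qed
  have unit: "h dvd 1" if gh: "f = g * h" and dg: "degree g = degree f" for g h :: "int poly"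
  proof -
    have "degree f = degree g + degree h" unfolding gh using f0 gh
      by (intro degree_mult_eq) auto
    hence "degree h = 0" using dg by simp
    then obtain c where h: "h = [:c:]" by (meson degree_eq_zeroE)
    have "lead_coeff g * c = 1" using monic lead_coeff_mult[of g h] by (simp add: gh h split: if_splits)
    hence "c dvd 1" by (metis dvd_triv_right)
    thus ?thesis by (simp add: h is_unit_const_poly_iff)
  qed
  show ?thesis
  proof (rule irreducibleI)
    show "f \<noteq> 0" by (rule f0)
    show "\<not> f dvd 1" using deg f0 by (auto simp: is_unit_poly_iff)
    fix g h assume gh: "f = g * h"
    have "p dvd Polynomial.coeff g 0 * Polynomial.coeff h 0"
      using low[of 0] deg by (simp add: gh Polynomial.coeff_mult)
    hence "p dvd Polynomial.coeff g 0 \<or> p dvd Polynomial.coeff h 0"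
      using p by (simp add: prime_dvd_mult_iff)
    thus "g dvd 1 \<or> h dvd 1"
    proof
      assume "p dvd Polynomial.coeff g 0"
      thus ?thesis using unit[OF gh] key[OF gh] by blast
    next
      assume "p dvd Polynomial.coeff h 0"
      thus ?thesis using unit[of h g] key[of h g] gh by (simp add: mult.commute)
    qed
  qed
qed

text \<open>
  This is the cyclotomic polynomial of order \<open>2^(s+1)\<close>.
\<close>

definition cyc_poly :: "nat \<Rightarrow> int poly"
  where "cyc_poly s = Polynomial.monom 1 (2 ^ s) + 1"

lemma degree_cyc_poly [simp]: "degree (cyc_poly s) = 2 ^ s"
  unfolding cyc_poly_def by (subst degree_add_eq_left) (auto simp: Polynomial.degree_monom_eq)

lemma lead_coeff_cyc_poly: "lead_coeff (cyc_poly s) = 1"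
  unfolding degree_cyc_poly by (simp add: cyc_poly_def)

lemma freshman_dream_pow2:
  "\<exists>r :: int poly. [:1, 1:] ^ (2 ^ s) = Polynomial.monom 1 (2 ^ s) + 1 + 2 * r"
proof (induction s)
  case 0
  show ?case by (rule exI[of _ 0]) (simp add: Polynomial.monom_altdef one_pCons)
next
  case (Suc s)
  then obtain r where r: "[:1, 1:] ^ (2 ^ s) = Polynomial.monom 1 (2 ^ s) + 1 + 2 * (r :: int poly)" by blast
  let ?y = "Polynomial.monom (1::int) (2 ^ s)"
  have "[:1, 1:] ^ (2 ^ Suc s) = ([:1, 1 :: int:] ^ (2 ^ s)) ^ 2"
    by (simp add: power_mult[symmetric] mult.commute)
  also have "\<dots> = ?y ^ 2 + 1 + 2 * (?y + 2 * r * (?y + 1) + 2 * r ^ 2)"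
    unfolding r by (simp add: power2_eq_square algebra_simps)
  also have "?y ^ 2 = Polynomial.monom 1 (2 ^ Suc s)"
    by (simp add: Polynomial.monom_power mult.commute)
  finally show ?case by blast
qed

lemma pcompose_power: "pcompose (p ^ k) q = pcompose p q ^ k" for p q :: "'a :: comm_semiring_1 poly"
  by (induction k) (simp_all add: pcompose_mult pcompose_1)

text \<open>
  After the substitution \<open>x \<mapsto> x + 1\<close> the Eisenstein criterion applies at the prime \<open>2\<close>.
\<close>

lemma cyc_poly_irreducible: "irreducible (cyc_poly s)"
proof -
  define f where "f = pcompose (cyc_poly s) [:1, 1:]"
  obtain r :: "int poly" where r: "[:1, 1:] ^ (2 ^ s) = Polynomial.monom 1 (2 ^ s) + 1 + 2 * r"
    using freshman_dream_pow2 by blast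
  have deg: "degree f = 2 ^ s" unfolding f_def by (simp add: degree_pcompose)
  have f1: "f = [:1, 1:] ^ (2 ^ s) + 1"
    unfolding f_def cyc_poly_def by (simp add: pcompose_add Polynomial.monom_altdef pcompose_power pcompose_pCons pcompose_1)
  have f2: "f = Polynomial.monom 1 (2 ^ s) + 2 * (1 + r)" unfolding f1 r by simp
  have "irreducible f"
  proof (rule eisenstein_monic[of 2])
    show "lead_coeff f = 1"
      unfolding f_def by (subst lead_coeff_comp) (simp_all add: lead_coeff_cyc_poly del: degree_cyc_poly)
    show "2 dvd Polynomial.coeff f i" if "i < degree f" for i
    proof -
      define w where "w = 1 + r"
      have "f = Polynomial.monom 1 (2 ^ s) + (w + w)" unfolding f2 w_def by (simp only: mult_2)
      hence "Polynomial.coeff f i = Polynomial.coeff (Polynomial.monom 1 (2 ^ s)) i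
          + (Polynomial.coeff w i + Polynomial.coeff w i)" by (simp only: Polynomial.coeff_add)
      hence "Polynomial.coeff f i = 2 * Polynomial.coeff w i" using that deg by simp
      thus ?thesis by simp
    qed
    have "Polynomial.coeff f 0 = poly f 0" by (simp add: poly_0_coeff_0)
    also have "\<dots> = 2" unfolding f1 by simp
    finally show "\<not> 2 ^ 2 dvd Polynomial.coeff f 0" by simp
  qed (simp_all add: deg)
  show ?thesis
  proof (rule irreducibleI)
    show "cyc_poly s \<noteq> 0" using lead_coeff_cyc_poly[of s] by auto
    show "\<not> cyc_poly s dvd 1" using degree_cyc_poly[of s] by (metis degree_pCons_0 is_unit_poly_iff power_not_zero zero_neq_numeral)
    fix g h assume "cyc_poly s = g * h"
    hence "f = pcompose g [:1, 1:] * pcompose h [:1, 1:]" by (simp add: f_def pcompose_mult)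
    hence "pcompose g [:1, 1:] dvd 1 \<or> pcompose h [:1, 1:] dvd 1"
      using \<open>irreducible f\<close> irreducibleD by blast
    moreover have "g dvd 1" if unit: "pcompose g [:1, 1:] dvd 1" for g :: "int poly"
    proof -
      obtain g' where "1 = pcompose g [:1, 1:] * g'" using unit by blast
      hence "pcompose (pcompose g [:1, 1:] * g') [:-1, 1:] = 1" by (metis pcompose_1)
      hence "g * pcompose g' [:-1, 1:] = 1"
        by (simp add: pcompose_mult pcompose_assoc[symmetric] pcompose_pCons pcompose_idR)
      thus ?thesis by (metis dvd_triv_left)
    qed
    ultimately show "g dvd 1 \<or> h dvd 1" by blast
  qed
qed

text \<open>
  A substitute for Bezout over the rationals that stays in \<open>\<int>[x]\<close>: take an element \<open>g\<close> of least
  degree in the ideal \<open>(p, f)\<close>. By pseudo-division it divides a nonzero multiple of every element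
  of the ideal. As \<open>f\<close> is prime, either it divides \<open>g\<close>, and with it \<open>p\<close>, or \<open>g\<close> is constant.
\<close>

lemma prime_poly_dvd_or_bezout:
  fixes f p :: "int poly"
  assumes f: "prime_elem f" and deg: "degree f > 0"
  shows "f dvd p \<or> (\<exists>u v m. m \<noteq> 0 \<and> u * p + v * f = [:m:])"
proof -
  define I where "I = {w. \<exists>u v. w = u * p + v * f}"
  have f0: "f \<noteq> 0" using deg by auto
  have fI: "f \<in> I" unfolding I_def by (auto intro: exI[of _ 0] exI[of _ 1])
  have "p = 1 * p + 0 * f" by simp
  hence pI: "p \<in> I" unfolding I_def by blast
  have closed: "a * w - b * w' \<in> I" if "w \<in> I" "w' \<in> I" for a b w w'
  proof -
    from that obtain u v u' v' where "w = u * p + v * f" "w' = u' * p + v' * f"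
      unfolding I_def by auto
    hence "a * w - b * w' = (a * u - b * u') * p + (a * v - b * v') * f"
      by (simp add: algebra_simps)
    thus ?thesis unfolding I_def by blast
  qed
  obtain g where g: "g \<in> I" "g \<noteq> 0" and min: "\<And>w. w \<in> I \<Longrightarrow> w \<noteq> 0 \<Longrightarrow> degree g \<le> degree w"
    using ex_has_least_nat[of "\<lambda>w. w \<in> I \<and> w \<noteq> 0" f degree] fI f0 by auto
  have div: "\<exists>c b. c \<noteq> 0 \<and> [:c:] * w = g * b" if w: "w \<in> I" for w
  proof -
    obtain b r where br: "pseudo_divmod w g = (b, r)" by force
    define c where "c = lead_coeff g ^ (Suc (degree w) - degree g)"
    have eq: "Polynomial.smult c w = g * b + r" and r: "r = 0 \<or> degree r < degree g"
      using pseudo_divmod[OF g(2) br] by (auto simp: c_def)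
    have "r = [:c:] * w - b * g" using eq by (simp add: algebra_simps)
    hence "r \<in> I" using closed[OF w g(1)] by metis
    hence "r = 0" using r min[of r] by fastforce
    moreover have "c \<noteq> 0" using g(2) by (simp add: c_def)
    ultimately show ?thesis using eq by (intro exI[of _ c] exI[of _ b]) simp
  qed
  have nc: "\<not> f dvd [:c:]" if "c \<noteq> 0" for c
    using that deg by (metis degree_pCons_0 dvd_imp_degree_le leD pCons_eq_0_iff)
  obtain c b where c: "c \<noteq> 0" and cb: "[:c:] * f = g * b" using div[OF fI] by blast
  have "f dvd g * b" unfolding cb[symmetric] by (rule dvd_triv_right)
  hence "f dvd g \<or> f dvd b" using f by (simp add: prime_elem_dvd_mult_iff)
  thus ?thesis
  proof
    assume fg: "f dvd g"
    obtain c b where c: "c \<noteq> 0" and cb: "[:c:] * p = g * b" using div[OF pI] by blast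
    have "f dvd [:c:] * p" unfolding cb using fg by simp
    hence "f dvd p" using f nc[OF c] by (simp add: prime_elem_dvd_mult_iff del: mult_pCons_left)
    thus ?thesis ..
  next
    assume "f dvd b"
    then obtain b' where "b = f * b'" by blast
    hence "f * [:c:] = f * (g * b')" using cb by (simp add: algebra_simps)
    hence gb: "g * b' = [:c:]" using f0 by (metis mult_cancel_left)
    hence "b' \<noteq> 0" using c by auto
    hence "degree g + degree b' = 0" using gb degree_mult_eq[of g b'] g(2) by simp
    then obtain m where m: "g = [:m:]" by (metis add_is_0 degree_eq_zeroE)
    moreover have "m \<noteq> 0" using g(2) m by simp
    moreover obtain u v where "g = u * p + v * f" using g(1) unfolding I_def by blast
    ultimately show ?thesis by metis
  qed
qed

lemma cyc_poly_prime: "prime_elem (cyc_poly s)"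
  using cyc_poly_irreducible by (rule irreducible_imp_prime_elem)

section \<open>Galois conjugation of multiplicative relations\<close>

definition int_eval :: "int poly \<Rightarrow> complex \<Rightarrow> complex"
  where "int_eval p z = poly (map_poly of_int p) z"

lemma int_eval_0 [simp]: "int_eval 0 z = 0"
  by (simp add: int_eval_def)

lemma int_eval_pCons [simp]: "int_eval (pCons a p) z = of_int a + z * int_eval p z"
  by (simp add: int_eval_def map_poly_pCons)

lemma int_eval_1 [simp]: "int_eval 1 z = 1"
  by (simp add: one_pCons)

lemma int_eval_add [simp]: "int_eval (p + r) z = int_eval p z + int_eval r z"
  by (induction p r rule: poly_induct2) (simp_all add: algebra_simps)

lemma int_eval_smult [simp]: "int_eval (Polynomial.smult c p) z = of_int c * int_eval p z"
  by (induction p) (simp_all add: algebra_simps)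

lemma int_eval_uminus [simp]: "int_eval (- p) z = - int_eval p z"
  using int_eval_smult[of "-1" p z] by simp

lemma int_eval_diff [simp]: "int_eval (p - r) z = int_eval p z - int_eval r z"
  using int_eval_add[of p "- r" z] by simp

lemma int_eval_mult [simp]: "int_eval (p * r) z = int_eval p z * int_eval r z"
  by (induction p) (simp_all add: algebra_simps)

lemma int_eval_power [simp]: "int_eval (p ^ k) z = int_eval p z ^ k"
  by (induction k) simp_all

lemma int_eval_monom [simp]: "int_eval (Polynomial.monom c k) z = of_int c * z ^ k"
  by (simp add: int_eval_def map_poly_monom poly_monom)

lemma int_eval_prod [simp]: "int_eval (\<Prod>i\<in>I. f i) z = (\<Prod>i\<in>I. int_eval (f i) z)"
  by (induction I rule: infinite_finite_induct) simp_all

lemma alpha_cis: "alpha n = cis (2 * pi / 2 ^ n)"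
  by (simp add: alpha_def cis_conv_exp mult_ac)

lemma alpha_nonzero [simp]: "alpha n \<noteq> 0"
  by (simp add: alpha_cis)

lemma alpha_powi: "alpha n powi a = cis (2 * pi * of_int a / 2 ^ n)"
  by (simp add: alpha_cis cis_power_int mult_ac)

lemma alpha_powi_cong:
  assumes "[a = b] (mod 2 ^ n)" shows "alpha n powi a = alpha n powi b"
proof -
  obtain k where k: "b = a + 2 ^ n * k" using assms by (metis cong_iff_lin)
  have "2 * pi * of_int b / 2 ^ n = 2 * pi * of_int a / 2 ^ n + 2 * pi * of_int k"
    unfolding k by (simp add: field_simps)
  hence "alpha n powi b = cis (2 * pi * of_int a / 2 ^ n) * cis (2 * pi * of_int k)"
    unfolding alpha_powi by (simp only: cis_mult)
  also have "cis (2 * pi * of_int k) = 1" by (rule cis_multiple_2pi) simp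
  finally show ?thesis by (simp add: alpha_powi)
qed

lemma alpha_pow_half:
  assumes "n \<ge> 1" shows "alpha n ^ (2 ^ (n - 1)) = -1"
proof -
  have "alpha n ^ (2 ^ (n - 1)) = cis (of_nat (2 ^ (n - 1)) * (2 * pi / 2 ^ n))"
    unfolding alpha_cis by (rule Complex.DeMoivre)
  also have "of_nat (2 ^ (n - 1)) * (2 * pi / 2 ^ n) = pi"
    using assms by (cases n) auto
  finally show ?thesis by simp
qed

lemma alpha_powi_pow_half:
  assumes "n \<ge> 1" "odd t" shows "(alpha n powi t) ^ (2 ^ (n - 1)) = -1"
proof -
  have "(alpha n powi t) ^ (2 ^ (n - 1)) = (alpha n ^ (2 ^ (n - 1))) powi t"
    by (metis mult.commute power_int_mult power_int_of_nat)
  also have "\<dots> = (-1) powi t" by (simp only: alpha_pow_half[OF assms(1)])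
  also have "\<dots> = -1" using assms(2) by simp
  finally show ?thesis .
qed

text \<open>
  The existence of the Galois automorphism \<open>\<alpha> \<mapsto> \<alpha>^t\<close>, expressed by polynomials.
\<close>

lemma int_eval_conjugate:
  assumes n: "n \<ge> 1" and t: "odd t" and p: "int_eval p (alpha n) = 0"
  shows "int_eval p (alpha n powi t) = 0"
proof -
  have cyc_poly: "int_eval (cyc_poly (n - 1)) (alpha n) = 0"
    using alpha_pow_half[OF n] by (simp add: cyc_poly_def)
  consider "cyc_poly (n - 1) dvd p" | u v m where "m \<noteq> 0" "u * p + v * cyc_poly (n - 1) = [:m:]"
    using prime_poly_dvd_or_bezout[OF cyc_poly_prime[of "n - 1"], of p] by auto
  thus ?thesis
  proof cases
    case 1
    then obtain r where r: "p = cyc_poly (n - 1) * r" by blast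
    show ?thesis using alpha_powi_pow_half[OF n t] by (simp add: r cyc_poly_def)
  next
    case 2
    have "int_eval [:m:] (alpha n) = 0" unfolding 2(2)[symmetric] using p cyc_poly by simp
    thus ?thesis using 2(1) by simp
  qed
qed

text \<open>
  The real number \<open>d n a\<close> in trigonometric form, so that absolute values and logarithms are
  available (see \<open>d_eq_real_unit\<close>).
\<close>

definition real_unit :: "nat \<Rightarrow> int \<Rightarrow> real"
  where "real_unit n a = 1 + 2 * cos (2 * pi * of_int a / 2 ^ n)"

lemma d_eq_real_unit: "d n a = of_real (real_unit n a)"
  unfolding d_def alpha_powi real_unit_def by (simp add: complex_eq_iff)

lemma real_unit_minus: "real_unit n (- a) = real_unit n a"
  by (simp add: real_unit_def)

lemma real_unit_cong:
  assumes "[a = b] (mod 2 ^ n)" shows "real_unit n a = real_unit n b"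
proof -
  have "[- a = - b] (mod 2 ^ n)" using assms by (simp add: cong_minus_minus_iff)
  hence "d n a = d n b" unfolding d_def using alpha_powi_cong[OF assms] alpha_powi_cong by metis
  thus ?thesis by (simp add: d_eq_real_unit)
qed

text \<open>
  With \<open>x = \<alpha>^a\<close> the element is \<open>(x^3 - 1) / (x (x - 1))\<close>. Since \<open>3\<close> is invertible modulo
  \<open>2^n\<close>, \<open>x\<close> is a power of \<open>x^3\<close>, so the inverse is a geometric sum in \<open>x^3\<close>. In particular
  \<open>d n a\<close> is a unit of the cyclotomic ring.
\<close>

lemma d_inverse:
  assumes n: "n \<ge> 1" and a: "odd a"
  obtains t where "d n a * (alpha n powi a * (\<Sum>i<t. (alpha n powi a) ^ (3 * i))) = 1"
proof -
  define x where "x = alpha n powi a"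
  have x0: "x \<noteq> 0" by (simp add: x_def)
  have "x ^ (2 ^ (n - 1)) = -1" unfolding x_def by (rule alpha_powi_pow_half[OF n a])
  hence x1: "x \<noteq> 1" by auto
  have "coprime 3 (2 ^ n :: nat)" by simp
  then obtain t where t: "[3 * t = 1] (mod (2 ^ n :: nat))"
    using cong_solve_coprime_nat[of 3 "2 ^ n"] by auto
  hence "[int (3 * t) = int 1] (mod int (2 ^ n))" by (simp only: cong_int_iff)
  hence "[a * int (3 * t) = a * 1] (mod 2 ^ n)" by (intro cong_scalar_left) simp
  hence "alpha n powi (a * int (3 * t)) = alpha n powi (a * 1)" by (rule alpha_powi_cong)
  hence xt: "x ^ (3 * t) = x"
    unfolding x_def by (simp add: power_int_mult power_int_of_nat del: of_nat_mult)
  have "x ^ (3 * t) - 1 = (x ^ 3 - 1) * (\<Sum>i<t. x ^ (3 * i))"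
    unfolding power_mult by (rule power_diff_1_eq)
  also have "x ^ 3 - 1 = (x - 1) * (x * (1 + x + inverse x))"
    using x0 by (simp add: algebra_simps eval_nat_numeral)
  finally have "(x - 1) * ((1 + x + inverse x) * (x * (\<Sum>i<t. x ^ (3 * i)))) = (x - 1) * 1"
    unfolding xt by (simp only: mult_ac mult_1_left mult_1_right)
  hence "(1 + x + inverse x) * (x * (\<Sum>i<t. x ^ (3 * i))) = 1"
    using x1 by (metis eq_iff_diff_eq_0 mult_left_cancel)
  thus ?thesis by (intro that[of t]) (simp add: d_def x_def power_int_minus)
qed

lemma d_nonzero: "n \<ge> 1 \<Longrightarrow> odd a \<Longrightarrow> d n a \<noteq> 0"
  by (metis d_inverse mult_zero_left zero_neq_one)

lemma real_unit_nonzero: "n \<ge> 1 \<Longrightarrow> odd a \<Longrightarrow> real_unit n a \<noteq> 0"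
  using d_nonzero[of n a] by (simp add: d_eq_real_unit)

definition log_unit :: "nat \<Rightarrow> int \<Rightarrow> real"
  where "log_unit n a = ln \<bar>real_unit n a\<bar>"

text \<open>
  Turns an additive relation between logarithms into an identity without inverses, to which
  polynomial evaluation applies. The doubled exponents absorb the signs.
\<close>

lemma sum_ln_eq_0_iff:
  fixes c :: "'a \<Rightarrow> int" and g :: "'a \<Rightarrow> real"
  assumes fin: "finite J" and nz: "\<And>j. j \<in> J \<Longrightarrow> g j \<noteq> 0"
  shows "(\<Sum>j\<in>J. of_int (c j) * ln \<bar>g j\<bar>) = 0 \<longleftrightarrow>
    (\<Prod>j\<in>J. g j ^ (2 * nat (c j))) = (\<Prod>j\<in>J. g j ^ (2 * nat (- c j)))"
proof -
  have prod: "(\<Prod>j\<in>J. g j ^ (2 * e j)) = exp (\<Sum>j\<in>J. 2 * of_nat (e j) * ln \<bar>g j\<bar>)" for e :: "'a \<Rightarrow> nat"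
  proof -
    have "g j ^ (2 * e j) = exp (2 * of_nat (e j) * ln \<bar>g j\<bar>)" if "j \<in> J" for j
    proof -
      have "g j ^ (2 * e j) = \<bar>g j\<bar> ^ (2 * e j)" by (simp add: power_even_abs)
      also have "\<dots> = exp (ln \<bar>g j\<bar>) ^ (2 * e j)" using nz[OF that] by simp
      also have "\<dots> = exp (of_nat (2 * e j) * ln \<bar>g j\<bar>)" by (rule exp_of_nat_mult[symmetric])
      finally show ?thesis by simp
    qed
    thus ?thesis using fin by (simp add: exp_sum)
  qed
  have "(\<Sum>j\<in>J. 2 * of_nat (nat (c j)) * ln \<bar>g j\<bar>) - (\<Sum>j\<in>J. 2 * of_nat (nat (- c j)) * ln \<bar>g j\<bar>)
      = (\<Sum>j\<in>J. 2 * (of_int (c j) * ln \<bar>g j\<bar>))"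
    unfolding sum_subtractf[symmetric]
  proof (intro sum.cong refl)
    fix j
    have "real (nat (c j)) - real (nat (- c j)) = of_int (c j)" by (cases "c j \<ge> 0") auto
    thus "2 * real (nat (c j)) * ln \<bar>g j\<bar> - 2 * real (nat (- c j)) * ln \<bar>g j\<bar> = 2 * (of_int (c j) * ln \<bar>g j\<bar>)"
      by (metis (no_types, lifting) mult.assoc left_diff_distrib right_diff_distrib)
  qed
  also have "\<dots> = 2 * (\<Sum>j\<in>J. of_int (c j) * ln \<bar>g j\<bar>)" by (simp add: sum_distrib_left)
  finally show ?thesis unfolding prod by auto
qed

text \<open>
  The relation says that a polynomial in \<open>\<alpha>\<close> vanishes; its value at \<open>\<alpha>^t\<close> vanishes as well.
\<close>

lemma log_relation_conjugate:
  fixes c :: "int \<Rightarrow> int"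
  assumes n: "n \<ge> 1" and fin: "finite J" and J: "\<And>j. j \<in> J \<Longrightarrow> odd j" and t: "odd t"
    and rel: "(\<Sum>j\<in>J. of_int (c j) * log_unit n j) = 0"
  shows "(\<Sum>j\<in>J. of_int (c j) * log_unit n (t * j)) = 0"
proof -
  define e :: "int \<Rightarrow> int poly" where
    "e j = 1 + Polynomial.monom 1 (nat (j mod 2 ^ n)) + Polynomial.monom 1 (nat ((- j) mod 2 ^ n))" for j
  have ev: "int_eval (e j) (alpha n powi s) = d n (s * j)" for j s
  proof -
    have "(alpha n powi s) ^ nat (i mod 2 ^ n) = alpha n powi (s * i)" for i
    proof -
      have "(alpha n powi s) ^ nat (i mod 2 ^ n) = alpha n powi (s * (i mod 2 ^ n))"
        by (simp add: power_int_mult flip: power_int_of_nat)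
      also have "\<dots> = alpha n powi (s * i)"
        by (intro alpha_powi_cong) (simp add: cong_def mod_mult_right_eq)
      finally show ?thesis .
    qed
    thus ?thesis by (simp add: e_def d_def)
  qed
  \<comment> \<open>positive exponents on one side, negative ones on the other; cf. \<open>sum_ln_eq_0_iff\<close>\<close>
  define p where "p = (\<Prod>j\<in>J. e j ^ (2 * nat (c j))) - (\<Prod>j\<in>J. e j ^ (2 * nat (- c j)))"
  have ev_p: "int_eval p (alpha n powi s) = of_real ((\<Prod>j\<in>J. real_unit n (s * j) ^ (2 * nat (c j)))
      - (\<Prod>j\<in>J. real_unit n (s * j) ^ (2 * nat (- c j))))" for s
    by (simp add: p_def ev d_eq_real_unit)
  have iff: "(\<Sum>j\<in>J. of_int (c j) * log_unit n (s * j)) = 0 \<longleftrightarrow> int_eval p (alpha n powi s) = 0"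
    if "odd s" for s
    unfolding log_unit_def ev_p of_real_eq_0_iff eq_iff_diff_eq_0[symmetric]
    by (rule sum_ln_eq_0_iff[OF fin]) (use n J that real_unit_nonzero in auto)
  have "int_eval p (alpha n) = 0" using iff[of 1] rel by simp
  thus ?thesis using iff[OF t] int_eval_conjugate[OF n t] by simp
qed

lemma log_unit_cong: "[a = b] (mod 2 ^ n) \<Longrightarrow> log_unit n a = log_unit n b"
  by (simp add: log_unit_def real_unit_cong)

lemma log_unit_minus: "log_unit n (- a) = log_unit n a"
  by (simp add: log_unit_def real_unit_minus)

lemma real_unit_antipode: "real_unit (Suc n) (a + 2 ^ n) = 1 - 2 * cos (2 * pi * of_int a / 2 ^ Suc n)"
proof -
  have "2 * pi * of_int (a + 2 ^ n) / 2 ^ Suc n = 2 * pi * of_int a / 2 ^ Suc n + pi"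
    by (simp add: field_simps)
  thus ?thesis unfolding real_unit_def by simp
qed

text \<open>
  Norm compatibility between consecutive levels:
  \<open>(1 + 2 cos \<theta>) (1 - 2 cos \<theta>) = - (1 + 2 cos (2 \<theta>))\<close>.
\<close>

lemma log_unit_norm:
  assumes "n \<ge> 1" "odd a"
  shows "log_unit (Suc n) a + log_unit (Suc n) (a + 2 ^ n) = log_unit n a"
proof -
  define \<theta> where "\<theta> = 2 * pi * of_int a / 2 ^ Suc n"
  have "real_unit n a = 1 + 2 * cos (2 * \<theta>)" by (simp add: real_unit_def \<theta>_def mult.assoc)
  moreover have "real_unit (Suc n) a = 1 + 2 * cos \<theta>" by (simp add: real_unit_def \<theta>_def)
  ultimately have "real_unit (Suc n) a * real_unit (Suc n) (a + 2 ^ n) = - real_unit n a"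
    unfolding real_unit_antipode \<theta>_def[symmetric] cos_double_cos[of \<theta>]
    by (simp add: algebra_simps power2_eq_square)
  hence "\<bar>real_unit (Suc n) a\<bar> * \<bar>real_unit (Suc n) (a + 2 ^ n)\<bar> = \<bar>real_unit n a\<bar>"
    by (simp flip: abs_mult)
  thus ?thesis unfolding log_unit_def
    using assms by (simp add: real_unit_nonzero flip: ln_mult_pos)
qed

text \<open>
  This is the only analytic input that prevents the pairings below from vanishing: the cosine of an
  acute angle is positive.
\<close>

lemma log_unit_antipode_neq:
  assumes "n \<ge> 2" shows "log_unit (Suc n) (1 + 2 ^ n) \<noteq> log_unit (Suc n) 1"
proof -
  define \<theta> where "\<theta> = 2 * pi / 2 ^ Suc n"
  have "(2::real) ^ 2 \<le> 2 ^ n" using assms by (intro power_increasing) auto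
  hence "\<theta> \<le> pi / 4" by (simp add: \<theta>_def field_simps)
  moreover have "\<theta> > 0" by (simp add: \<theta>_def)
  ultimately have "cos \<theta> > 0" using pi_gt_zero by (intro cos_gt_zero_pi) linarith+
  hence "\<bar>1 - 2 * cos \<theta>\<bar> < \<bar>1 + 2 * cos \<theta>\<bar>" by linarith
  moreover have "real_unit (Suc n) (1 + 2 ^ n) \<noteq> 0" using assms by (intro real_unit_nonzero) auto
  moreover have "real_unit (Suc n) (1 + 2 ^ n) = 1 - 2 * cos \<theta>"
    unfolding real_unit_antipode by (simp add: \<theta>_def)
  moreover have "real_unit (Suc n) 1 = 1 + 2 * cos \<theta>" by (simp add: real_unit_def \<theta>_def)
  ultimately show ?thesis unfolding log_unit_def by simp
qed

section \<open>Powers of 3 modulo powers of 2\<close>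

lemma three_pow_two_pow:
  assumes "s \<ge> 1" shows "\<exists>o' :: int. odd o' \<and> 3 ^ (2 ^ s) = 1 + 2 ^ (s + 2) * o'"
  using assms
proof (induction s rule: dec_induct)
  case base
  show ?case by (rule exI[of _ 1]) simp
next
  case (step s)
  then obtain w :: int where w: "odd w" "3 ^ (2 ^ s) = 1 + 2 ^ (s + 2) * w" by blast
  have "(3::int) ^ (2 ^ Suc s) = (3 ^ (2 ^ s)) ^ 2" by (simp add: power_mult[symmetric] mult.commute)
  also have "\<dots> = 1 + 2 ^ (Suc s + 2) * (w + 2 ^ (s + 1) * w ^ 2)"
    unfolding w(2) by (simp add: power2_eq_square algebra_simps)
  finally show ?case using w(1) by (intro exI[of _ "w + 2 ^ (s + 1) * w ^ 2"]) simp
qed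

lemma three_pow_cong_half:
  fixes a :: int
  assumes "n \<ge> 3" "odd a" shows "[a * 3 ^ (2 ^ (n - 2)) = a + 2 ^ n] (mod 2 ^ Suc n)"
proof -
  have "n - 2 \<ge> 1" using assms by simp
  then obtain w :: int where w: "odd w" "3 ^ (2 ^ (n - 2)) = 1 + 2 ^ (n - 2 + 2) * w"
    using three_pow_two_pow by blast
  have "n - 2 + 2 = n" using assms by simp
  hence eq: "a * 3 ^ (2 ^ (n - 2)) = a + 2 ^ n * (a * w)" using w(2) by (simp add: algebra_simps)
  have "even (a * w - 1)" using w(1) assms(2) by simp
  then obtain v where "a * w - 1 = 2 * v" by blast
  hence "a * w = 1 + 2 * v" by simp
  hence "a * 3 ^ (2 ^ (n - 2)) = a + 2 ^ n + 2 ^ Suc n * v" unfolding eq by (simp add: algebra_simps)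
  thus ?thesis by (simp add: cong_def)
qed

text \<open>
  Lifting from \<open>2^n\<close> to \<open>2^(n+1)\<close> either keeps the representative \<open>\<plusminus>3^i\<close> or adds \<open>2^n\<close> to it,
  which amounts to multiplication by \<open>3^(2^(n-2))\<close>.
\<close>

lemma odd_cong_pm_three_pow:
  fixes j :: int
  assumes "n \<ge> 3" "odd j"
  shows "\<exists>i < 2 ^ (n - 2). [j = 3 ^ i] (mod 2 ^ n) \<or> [j = - (3 ^ i)] (mod 2 ^ n)"
  using assms(1)
proof (induction n rule: dec_induct)
  case base
  have "j mod 8 = 1 \<or> j mod 8 = 3 \<or> j mod 8 = 5 \<or> j mod 8 = 7"
    using assms(2) by presburger
  hence "(\<exists>i\<in>{0, 1}. [j = 3 ^ i] (mod 8) \<or> [j = - (3 ^ i)] (mod 8))"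
    by (auto simp: cong_def)
  thus ?case by force
next
  case (step n)
  then obtain i \<epsilon> :: "_" where i: "i < 2 ^ (n - 2)" and eps: "\<epsilon> = 1 \<or> \<epsilon> = -1"
    and "[j = \<epsilon> * 3 ^ i] (mod 2 ^ n)"
    by (metis mult_1 mult_minus1)
  then obtain k :: int where k: "j = \<epsilon> * 3 ^ i + 2 ^ n * k"
    by (metis cong_iff_lin cong_sym)
  have lt: "i < 2 ^ (Suc n - 2)" "i + 2 ^ (n - 2) < 2 ^ (Suc n - 2)"
  proof -
    have "Suc n - 2 = Suc (n - 2)" using step(1) by simp
    hence "(2::nat) ^ (Suc n - 2) = 2 ^ (n - 2) + 2 ^ (n - 2)" by (simp only: power_Suc mult_2)
    thus "i < 2 ^ (Suc n - 2)" "i + 2 ^ (n - 2) < 2 ^ (Suc n - 2)" using i by auto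
  qed
  show ?case
  proof (cases "even k")
    case True
    then obtain k' where "k = 2 * k'" by blast
    hence "j = \<epsilon> * 3 ^ i + 2 ^ Suc n * k'" using k by simp
    hence "[j = \<epsilon> * 3 ^ i] (mod 2 ^ Suc n)" by (metis cong_iff_lin cong_sym)
    thus ?thesis using lt(1) eps by auto
  next
    case False
    then obtain k' where k': "k = 1 + 2 * k'" by (metis oddE add.commute)
    have "[j = \<epsilon> * 3 ^ i + 2 ^ n] (mod 2 ^ Suc n)"
    proof -
      have "j = \<epsilon> * 3 ^ i + 2 ^ n + 2 ^ Suc n * k'" using k unfolding k' by (simp add: algebra_simps)
      thus ?thesis by (metis cong_iff_lin cong_sym)
    qed
    also have "[\<epsilon> * 3 ^ i + 2 ^ n = \<epsilon> * 3 ^ i * 3 ^ (2 ^ (n - 2))] (mod 2 ^ Suc n)"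
      by (rule cong_sym, rule three_pow_cong_half[OF step(1)]) (use eps in auto)
    finally have "[j = \<epsilon> * 3 ^ i * 3 ^ (2 ^ (n - 2))] (mod 2 ^ Suc n)" .
    hence "[j = \<epsilon> * 3 ^ (i + 2 ^ (n - 2))] (mod 2 ^ Suc n)" by (simp add: power_add mult.assoc)
    thus ?thesis using lt(2) eps by auto
  qed
qed

section \<open>Multiplicative independence of the cyclotomic units\<close>

text \<open>
  For \<open>l i = log |d(3^i)|\<close> this is the logarithm of the unit obtained by letting the polynomial act
  on \<open>d(1)\<close>, where \<open>x\<close> acts as the Galois automorphism \<open>\<alpha> \<mapsto> \<alpha>^3\<close>.
\<close>

definition pairing :: "(nat \<Rightarrow> real) \<Rightarrow> int poly \<Rightarrow> real"
  where "pairing l p = (\<Sum>i\<le>degree p. of_int (Polynomial.coeff p i) * l i)"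

lemma pairing_altdef:
  assumes "degree p \<le> m" shows "pairing l p = (\<Sum>i\<le>m. of_int (Polynomial.coeff p i) * l i)"
  unfolding pairing_def using assms
  by (intro sum.mono_neutral_left) (auto simp: coeff_eq_0)

lemma pairing_add: "pairing l (p + r) = pairing l p + pairing l r"
proof -
  let ?m = "max (degree p) (degree r)"
  show ?thesis
    by (subst (1 2 3) pairing_altdef[of _ ?m])
      (auto simp: degree_add_le algebra_simps sum.distrib)
qed

lemma pairing_smult: "pairing l (Polynomial.smult c p) = of_int c * pairing l p"
  by (subst pairing_altdef[of _ "degree p"])
    (auto simp: pairing_def sum_distrib_left algebra_simps degree_smult_le)

lemma pairing_0 [simp]: "pairing l 0 = 0"
  by (simp add: pairing_def)

lemma pairing_diff: "pairing l (p - r) = pairing l p - pairing l r"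
  using pairing_add[of l "p - r" r] by simp

lemma pairing_pCons: "pairing l (pCons a p) = of_int a * l 0 + pairing (\<lambda>i. l (Suc i)) p"
  by (subst pairing_altdef[of _ "Suc (degree p)"])
    (simp_all add: degree_pCons_le sum.atMost_Suc_shift pairing_def del: sum.atMost_Suc)

lemma pairing_monom_mult: "pairing l (Polynomial.monom 1 k * p) = pairing (\<lambda>i. l (i + k)) p"
proof (induction k arbitrary: l)
  case 0
  show ?case by (simp add: Polynomial.monom_0)
next
  case (Suc k)
  have "Polynomial.monom 1 (Suc k) * p = pCons 0 (Polynomial.monom 1 k * p)"
    by (simp add: monom_Suc)
  thus ?case by (simp add: pairing_pCons Suc.IH)
qed

text \<open>
  Polynomials all of whose shifts pair to zero form an ideal.
\<close>

lemma pairing_mult_eq_0: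
  assumes "\<And>k. pairing l (Polynomial.monom 1 k * p) = 0"
  shows "pairing l (r * p) = 0"
  using assms
proof (induction r arbitrary: p)
  case (pCons a r)
  have "pairing l (r * (pCons 0 p)) = 0"
  proof (rule pCons.IH)
    fix k
    have "Polynomial.monom 1 k * pCons 0 p = Polynomial.monom 1 (Suc k) * p"
      by (simp add: monom_Suc)
    thus "pairing l (Polynomial.monom 1 k * pCons 0 p) = 0" by (simp only: pCons.prems)
  qed
  moreover have "pairing l p = 0" using pCons.prems[of 0] by (simp add: Polynomial.monom_0)
  ultimately show ?case by (simp add: pairing_add pairing_smult)
qed simp

lemma pairing_cyc_poly_mult: "pairing l (cyc_poly r * p) = pairing (\<lambda>i. l i + l (i + 2 ^ r)) p"
  unfolding cyc_poly_def by (simp add: ring_distribs pairing_add pairing_monom_mult)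
    (simp add: pairing_def sum.distrib algebra_simps)

text \<open>
  Iterated difference of squares, \<open>(y - 1) (y + 1) = y\<^sup>2 - 1\<close>.
\<close>

lemma telescope_cyc_poly:
  assumes "s \<le> t"
  shows "(Polynomial.monom 1 (2 ^ s) - 1) * (\<Prod>r\<in>{s..<t}. cyc_poly r) = Polynomial.monom 1 (2 ^ t) - 1"
  using assms
proof (induction t rule: dec_induct)
  case base
  show ?case by simp
next
  case (step t)
  have "(Polynomial.monom 1 (2 ^ t) - 1 :: int poly) * cyc_poly t = Polynomial.monom 1 (2 ^ t) ^ 2 - 1"
    unfolding cyc_poly_def by (simp add: power2_eq_square algebra_simps)
  also have "\<dots> = Polynomial.monom 1 (2 ^ Suc t) - 1" by (simp add: Polynomial.monom_power mult.commute)
  finally show ?case using step by (simp add: mult.assoc[symmetric] prod.atLeastLessThan_Suc)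
qed

abbreviation log_seq :: "nat \<Rightarrow> nat \<Rightarrow> real"
  where "log_seq n i \<equiv> log_unit n (3 ^ i)"

lemma log_seq_norm:
  assumes "n \<ge> 3" shows "log_seq (Suc n) i + log_seq (Suc n) (i + 2 ^ (n - 2)) = log_seq n i"
proof -
  have "log_seq (Suc n) (i + 2 ^ (n - 2)) = log_unit (Suc n) (3 ^ i + 2 ^ n)"
    unfolding power_add by (intro log_unit_cong three_pow_cong_half) (use assms in auto)
  thus ?thesis using log_unit_norm[of n "3 ^ i"] assms by simp
qed

text \<open>
  The product on the left is the norm element for the descent from level \<open>n\<close> to level \<open>m\<close>.
\<close>

lemma pairing_log_seq_norm:
  assumes "3 \<le> m" "m \<le> n"
  shows "pairing (log_seq n) ((\<Prod>r\<in>{m - 2..<n - 2}. cyc_poly r) * p) = pairing (log_seq m) p"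
  using assms(2)
proof (induction n rule: dec_induct)
  case base
  show ?case by simp
next
  case (step n)
  have "{m - 2..<Suc n - 2} = insert (n - 2) {m - 2..<n - 2}" using assms step by auto
  hence "(\<Prod>r\<in>{m - 2..<Suc n - 2}. cyc_poly r) * p = cyc_poly (n - 2) * ((\<Prod>r\<in>{m - 2..<n - 2}. cyc_poly r) * p)"
    by (simp add: mult.assoc)
  hence "pairing (log_seq (Suc n)) ((\<Prod>r\<in>{m - 2..<Suc n - 2}. cyc_poly r) * p)
      = pairing (log_seq n) ((\<Prod>r\<in>{m - 2..<n - 2}. cyc_poly r) * p)"
    using log_seq_norm[of n] assms(1) step.hyps by (simp only: pairing_cyc_poly_mult)
  thus ?case using step by simp
qed

lemma pairing_one: "pairing l 1 = l 0"
  by (simp add: pairing_def)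

text \<open>
  The polynomial is \<open>(x^N - 1) / (x^(2^s) + 1)\<close> with \<open>N = 2^(n-2)\<close>. The product descends to level
  \<open>s + 3\<close>, where \<open>x^(2^s)\<close> maps the primitive root of unity \<open>\<beta>\<close> of that level to \<open>-\<beta>\<close>,
  or for \<open>s = 0\<close> to \<open>-1/\<beta>\<close>; so the pairing compares \<open>|1 - 2 cos \<theta>|\<close> and \<open>|1 + 2 cos \<theta>|\<close>.
\<close>

lemma pairing_subfield_unit_nonzero:
  assumes "n \<ge> 3" "s < n - 2"
  shows "pairing (log_seq n) ((\<Prod>r\<in>{Suc s..<n - 2}. cyc_poly r) * (Polynomial.monom 1 (2 ^ s) - 1)) \<noteq> 0"
proof -
  have eq: "pairing (log_seq n) ((\<Prod>r\<in>{Suc s..<n - 2}. cyc_poly r) * (Polynomial.monom 1 (2 ^ s) - 1))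
      = log_seq (s + 3) (2 ^ s) - log_seq (s + 3) 0"
    using pairing_log_seq_norm[of "s + 3" n "Polynomial.monom 1 (2 ^ s) - 1"] assms
      pairing_monom_mult[of _ "2 ^ s" 1] by (simp add: pairing_diff pairing_one)
  have "log_seq (s + 3) (2 ^ s) = log_unit (Suc (s + 2)) (1 + 2 ^ (s + 2))"
  proof (cases "s = 0")
    case True
    have "log_unit 3 3 = log_unit 3 (- 3)" by (simp add: log_unit_minus)
    also have "\<dots> = log_unit 3 5" by (rule log_unit_cong) (simp add: cong_def)
    finally show ?thesis using True by (simp add: numeral_eq_Suc)
  next
    case False
    hence "[3 ^ (2 ^ s) = 1 + 2 ^ (s + 2)] (mod 2 ^ Suc (s + 2) :: int)"
      using three_pow_cong_half[of "s + 2" 1] by simp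
    hence "log_unit (Suc (s + 2)) (3 ^ (2 ^ s)) = log_unit (Suc (s + 2)) (1 + 2 ^ (s + 2))"
      by (rule log_unit_cong)
    thus ?thesis by (simp add: numeral_3_eq_3)
  qed
  also have "\<dots> \<noteq> log_unit (Suc (s + 2)) 1" by (rule log_unit_antipode_neq) simp
  finally show ?thesis unfolding eq by (simp add: numeral_eq_Suc)
qed

lemma log_seq_periodic:
  assumes "n \<ge> 3" shows "log_seq n (i + 2 ^ (n - 2)) = log_seq n i"
proof -
  have "[3 ^ i * 3 ^ (2 ^ (n - 2)) = 3 ^ i + 2 ^ n] (mod 2 ^ Suc n :: int)"
    using three_pow_cong_half[of n "3 ^ i"] assms by simp
  hence "[3 ^ i * 3 ^ (2 ^ (n - 2)) = 3 ^ i + 2 ^ n] (mod 2 ^ n :: int)"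
    by (rule cong_dvd_modulus) simp
  hence "[3 ^ i * 3 ^ (2 ^ (n - 2)) = 3 ^ i] (mod 2 ^ n :: int)"
    by (simp add: cong_def)
  thus ?thesis unfolding power_add by (rule log_unit_cong)
qed

text \<open>
  Galois conjugation by powers of \<open>3\<close> turns the vanishing of one pairing into the hypothesis of
  \<open>pairing_mult_eq_0\<close>.
\<close>

lemma pairing_conjugate:
  assumes n: "n \<ge> 1" and 0: "pairing (log_seq n) p = 0"
  shows "pairing (log_seq n) (Polynomial.monom 1 k * p) = 0"
proof -
  define J :: "int set" where "J = (\<lambda>i. 3 ^ i) ` {..degree p}"
  have inj: "inj_on (\<lambda>i. 3 ^ i :: int) {..degree p}" by (auto intro: inj_onI)
  define c where "c j = Polynomial.coeff p (the_inv_into {..degree p} (\<lambda>i. 3 ^ i :: int) j)" for j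
  have *: "(\<Sum>j\<in>J. of_int (c j) * log_unit n (t * j)) = (\<Sum>i\<le>degree p. of_int (Polynomial.coeff p i) * log_unit n (t * 3 ^ i))" for t
    unfolding J_def c_def by (subst sum.reindex[OF inj], intro sum.cong refl) (simp add: the_inv_into_f_f[OF inj])
  have "(\<Sum>j\<in>J. of_int (c j) * log_unit n (3 ^ k * j)) = 0"
  proof (rule log_relation_conjugate[OF n])
    show "(\<Sum>j\<in>J. of_int (c j) * log_unit n j) = 0"
      using *[of 1] 0 by (simp add: pairing_def)
  qed (auto simp: J_def)
  hence "(\<Sum>i\<le>degree p. of_int (Polynomial.coeff p i) * log_unit n (3 ^ k * 3 ^ i)) = 0" by (simp add: *)
  thus ?thesis unfolding pairing_monom_mult by (simp add: pairing_def power_add mult.commute)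
qed

text \<open>
  Otherwise \<open>u p + v (x^(2^s) + 1)\<close> is a nonzero integer \<open>m\<close>. Multiplied by the complementary
  factor \<open>g\<close> of \<open>x^N - 1\<close>, both summands pair to zero, the second one by periodicity; but \<open>m g\<close>
  does not.
\<close>

lemma cyc_poly_dvd_of_pairing_eq_0:
  assumes n: "n \<ge> 3" and s: "s < n - 2" and 0: "pairing (log_seq n) p = 0"
  shows "cyc_poly s dvd p"
proof (rule ccontr)
  assume "\<not> cyc_poly s dvd p"
  then obtain u v m where m: "m \<noteq> 0" and uv: "u * p + v * cyc_poly s = [:m:]"
    using prime_poly_dvd_or_bezout[OF cyc_poly_prime[of s], of p] by auto
  define g where "g = (\<Prod>r\<in>{Suc s..<n - 2}. cyc_poly r) * (Polynomial.monom 1 (2 ^ s) - 1)"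
  have "{s..<n - 2} = insert s {Suc s..<n - 2}" using s by auto
  hence "cyc_poly s * g = (Polynomial.monom 1 (2 ^ s) - 1) * (\<Prod>r\<in>{s..<n - 2}. cyc_poly r)"
    unfolding g_def by (simp add: mult_ac)
  also have "\<dots> = Polynomial.monom 1 (2 ^ (n - 2)) - 1" using telescope_cyc_poly s by simp
  finally have Xg: "cyc_poly s * g = Polynomial.monom 1 (2 ^ (n - 2)) - 1" .
  have "Polynomial.smult m g = g * (u * p + v * cyc_poly s)" unfolding uv by simp
  also have "\<dots> = (g * u) * p + v * (cyc_poly s * g)" by (simp add: algebra_simps)
  finally have "of_int m * pairing (log_seq n) g
      = pairing (log_seq n) ((g * u) * p) + pairing (log_seq n) (v * (cyc_poly s * g))"
    by (simp only: pairing_add flip: pairing_smult)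
  moreover have "pairing (log_seq n) ((g * u) * p) = 0"
    by (rule pairing_mult_eq_0, rule pairing_conjugate) (use n 0 in auto)
  moreover have "pairing (log_seq n) (v * (cyc_poly s * g)) = 0" unfolding Xg
  proof (rule pairing_mult_eq_0)
    fix k
    have "Polynomial.monom 1 k * (Polynomial.monom 1 (2 ^ (n - 2)) - 1)
      = Polynomial.monom 1 (k + 2 ^ (n - 2)) * 1 - Polynomial.monom (1 :: int) k * 1"
      by (simp add: algebra_simps Polynomial.mult_monom)
    thus "pairing (log_seq n) (Polynomial.monom 1 k * (Polynomial.monom 1 (2 ^ (n - 2)) - 1)) = 0"
      by (simp only: pairing_diff pairing_monom_mult) (simp add: pairing_one log_seq_periodic[OF n])
  qed
  ultimately have "pairing (log_seq n) g = 0" using m by simp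
  thus False using pairing_subfield_unit_nonzero[OF n s] by (simp add: g_def)
qed

lemma degree_prod_cyc_poly: "degree (\<Prod>r<t. cyc_poly r) = 2 ^ t - 1"
proof (induction t)
  case (Suc t)
  have nz: "cyc_poly s \<noteq> 0" for s using cyc_poly_prime by (metis prime_elem_not_zeroI)
  have "(\<Prod>r<t. cyc_poly r) \<noteq> 0" using nz by simp
  hence "degree (\<Prod>r<Suc t. cyc_poly r) = 2 ^ t - 1 + 2 ^ t" using Suc nz by (simp add: degree_mult_eq)
  thus ?case by simp
qed simp

text \<open>
  The factors are prime, and the degree \<open>2^t\<close> of the next one exceeds the degree \<open>2^t - 1\<close> of the
  product of the previous ones.
\<close>

lemma prod_cyc_poly_dvd:
  assumes "\<And>s. s < t \<Longrightarrow> cyc_poly s dvd p" shows "(\<Prod>r<t. cyc_poly r) dvd p"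
  using assms
proof (induction t)
  case (Suc t)
  hence "(\<Prod>r<t. cyc_poly r) dvd p" by simp
  then obtain w where w: "p = (\<Prod>r<t. cyc_poly r) * w" by blast
  have "cyc_poly t dvd (\<Prod>r<t. cyc_poly r) * w" using Suc.prems[of t] w by simp
  moreover have "\<not> cyc_poly t dvd (\<Prod>r<t. cyc_poly r)"
  proof
    assume "cyc_poly t dvd (\<Prod>r<t. cyc_poly r)"
    moreover have "(\<Prod>r<t. cyc_poly r) \<noteq> 0" using cyc_poly_prime by (auto simp: prime_elem_def)
    ultimately have "degree (cyc_poly t) \<le> degree (\<Prod>r<t. cyc_poly r)" by (rule dvd_imp_degree_le)
    moreover have "(0 :: nat) < 2 ^ t" by simp
    ultimately show False unfolding degree_prod_cyc_poly degree_cyc_poly by linarith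
  qed
  ultimately have "cyc_poly t dvd w" using cyc_poly_prime[of t] by (simp add: prime_elem_dvd_mult_iff)
  thus ?case unfolding w by (simp add: mult_dvd_mono)
qed simp

text \<open>
  Below degree \<open>N = 2^(n-2)\<close> every relation is a multiple of the norm element
  \<open>1 + x + ... + x^(N-1)\<close>.
\<close>

lemma log_seq_relation_constant:
  assumes n: "n \<ge> 3" and deg: "degree p < 2 ^ (n - 2)" and 0: "pairing (log_seq n) p = 0"
    and i: "i < 2 ^ (n - 2)"
  shows "Polynomial.coeff p i = Polynomial.coeff p 0"
proof -
  define P where "P = (\<Prod>r<n - 2. cyc_poly r)"
  have P0: "P \<noteq> 0" unfolding P_def using cyc_poly_prime by (auto simp: prime_elem_def)
  have "P dvd p" unfolding P_def using cyc_poly_dvd_of_pairing_eq_0[OF n _ 0] by (intro prod_cyc_poly_dvd) auto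
  then obtain w where w: "p = P * w" by blast
  have "degree w = 0"
  proof (cases "w = 0")
    case False
    hence "degree p = (2 ^ (n - 2) - 1) + degree w"
      unfolding w using P0 by (simp add: degree_mult_eq P_def degree_prod_cyc_poly)
    thus ?thesis using deg by linarith
  qed simp
  then obtain c where "w = [:c:]" by (meson degree_eq_zeroE)
  hence p: "p = Polynomial.smult c P" by (simp add: w)
  have tel: "pCons 0 P - P = Polynomial.monom 1 (2 ^ (n - 2)) - 1"
    using telescope_cyc_poly[of 0 "n - 2"]
    by (simp add: P_def lessThan_atLeast0 left_diff_distrib monom_Suc Polynomial.monom_0)
  have "Polynomial.coeff P i = Polynomial.coeff P 0" using i
  proof (induction i)
    case (Suc i)
    have "Polynomial.coeff (pCons 0 P - P) (Suc i) = 0" unfolding tel using Suc.prems by simp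
    thus ?case using Suc by simp
  qed simp
  thus ?thesis by (simp add: p)
qed

lemma cong_up_to_sign:
  fixes i j z m :: int
  assumes "[i = z] (mod m) \<or> [i = - z] (mod m)" "[j = z] (mod m) \<or> [j = - z] (mod m)"
  shows "[i = j] (mod m) \<or> [i = - j] (mod m)"
proof -
  have "m dvd i - z \<or> m dvd i + z" "m dvd j - z \<or> m dvd j + z"
    using assms by (simp_all add: cong_iff_dvd_diff)
  hence "m dvd (i - z) - (j - z) \<or> m dvd (i + z) - (j + z) \<or> m dvd (i - z) + (j + z) \<or> m dvd (i + z) + (j - z)"
    using dvd_diff[of m "i - z" "j - z"] dvd_diff[of m "i + z" "j + z"]
      dvd_add[of m "i - z" "j + z"] dvd_add[of m "i + z" "j - z"] by argo
  thus ?thesis by (auto simp: cong_iff_dvd_diff algebra_simps)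
qed

lemma ln_abs_power_int: "ln \<bar>x powi m\<bar> = of_int m * ln \<bar>x :: real\<bar>"
  by (cases "x = 0") (auto simp: power_int_def power_abs abs_inverse ln_realpow ln_inverse power_inverse power_0_left)

text \<open>
  Writing each index as \<open>\<plusminus>3^i\<close> turns the relation into a polynomial of degree less than
  \<open>2^(n-2)\<close>, whose coefficients agree by \<open>log_seq_relation_constant\<close>. The coefficient belonging to
  the missing index \<open>2^(n-1) - 1\<close> is zero.
\<close>

lemma d_multiplicatively_independent:
  fixes c :: "int \<Rightarrow> int"
  assumes n: "n \<ge> 3"
    and rel: "(\<Prod>j\<in>{j. odd j \<and> 1 \<le> j \<and> j \<le> 2 ^ (n - 1) - 3}. d n j powi c j) = 1"
    and j: "odd j" "1 \<le> j" "j \<le> 2 ^ (n - 1) - 3"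
  shows "c j = 0"
proof -
  define J where "J = {j :: int. odd j \<and> 1 \<le> j \<and> j \<le> 2 ^ (n - 1) - 3}"
  have finJ: "finite J" by (rule finite_subset[of _ "{1..2 ^ (n - 1)}"]) (auto simp: J_def)
  define k where "k j = (SOME i. i < 2 ^ (n - 2) \<and> ([j = 3 ^ i] (mod 2 ^ n) \<or> [j = - (3 ^ i)] (mod 2 ^ n)))" for j :: int
  have k: "k j < 2 ^ (n - 2) \<and> ([j = 3 ^ k j] (mod 2 ^ n) \<or> [j = - (3 ^ k j)] (mod 2 ^ n))" if "odd j" for j
    unfolding k_def by (rule someI_ex) (use odd_cong_pm_three_pow[OF n that] in blast)
  have inj: "i = j" if "odd i" "odd j" "1 \<le> i" "i < 2 ^ (n - 1)" "1 \<le> j" "j < 2 ^ (n - 1)" "k i = k j" for i j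
  proof -
    have "[i = j] (mod 2 ^ n) \<or> [i = - j] (mod 2 ^ n)"
      using k[OF that(1)] k[OF that(2)] unfolding that(7) by (intro cong_up_to_sign[of i "3 ^ k j" _ j]) auto
    moreover have pow: "(2::int) ^ n = 2 * 2 ^ (n - 1)" using n by (cases n) auto
    moreover have False if "[i = - j] (mod 2 ^ n)"
    proof -
      have "2 ^ n dvd i + j" using that by (simp add: cong_iff_dvd_diff)
      hence "2 ^ n \<le> i + j" using \<open>1 \<le> i\<close> \<open>1 \<le> j\<close> by (intro zdvd_imp_le) auto
      thus False using \<open>i < _\<close> \<open>j < _\<close> pow by linarith
    qed
    ultimately have "[i = j] (mod 2 ^ n)" by blast
    thus ?thesis using that pow by (intro cong_less_imp_eq_int) auto
  qed
  have log_k: "log_unit n j = log_seq n (k j)" if "odd j" for j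
    using k[OF that] log_unit_cong log_unit_minus by metis
  define p where "p = (\<Sum>j\<in>J. Polynomial.monom (c j) (k j))"
  have deg: "degree p < 2 ^ (n - 2)" unfolding p_def
  proof (intro degree_sum_less)
    fix j assume "j \<in> J"
    thus "degree (Polynomial.monom (c j) (k j)) < 2 ^ (n - 2)"
      using k[of j] degree_monom_le[of "c j" "k j"] by (auto simp: J_def)
  qed simp
  have coeff: "Polynomial.coeff p (k j) = c j" if "j \<in> J" for j
  proof -
    have "Polynomial.coeff p (k j) = (\<Sum>i\<in>J. if i = j then c j else 0)"
      unfolding p_def Polynomial.coeff_sum
      using inj that by (intro sum.cong) (auto simp: J_def)
    thus ?thesis using that finJ by simp
  qed
  have "\<bar>\<Prod>j\<in>J. real_unit n j powi c j\<bar> = 1"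
  proof -
    have "of_real (\<Prod>j\<in>J. real_unit n j powi c j) = (1 :: complex)"
      using rel by (simp add: J_def d_eq_real_unit of_real_power_int)
    thus ?thesis by (metis abs_1 of_real_eq_1_iff)
  qed
  moreover have "ln \<bar>\<Prod>j\<in>J. real_unit n j powi c j\<bar> = (\<Sum>j\<in>J. of_int (c j) * log_unit n j)"
  proof -
    have "ln \<bar>\<Prod>j\<in>J. real_unit n j powi c j\<bar> = (\<Sum>j\<in>J. ln \<bar>real_unit n j powi c j\<bar>)"
      unfolding abs_prod using n by (intro ln_prod[OF finJ]) (auto simp: J_def real_unit_nonzero)
    also have "\<dots> = (\<Sum>j\<in>J. of_int (c j) * log_unit n j)"
      by (intro sum.cong refl) (simp add: log_unit_def ln_abs_power_int)
    finally show ?thesis .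
  qed
  ultimately have "(\<Sum>j\<in>J. of_int (c j) * log_unit n j) = 0" by simp
  moreover have "pairing (log_seq n) p = (\<Sum>j\<in>J. of_int (c j) * log_unit n j)"
  proof -
    have "pairing (log_seq n) p = (\<Sum>j\<in>J. pairing (log_seq n) (Polynomial.monom (c j) (k j)))"
      unfolding p_def using finJ by (induction J) (simp_all add: pairing_add)
    also have "\<dots> = (\<Sum>j\<in>J. of_int (c j) * log_unit n j)"
    proof (intro sum.cong refl)
      fix j assume "j \<in> J"
      hence "odd j" by (simp add: J_def)
      have "Polynomial.monom (c j) (k j) = Polynomial.smult (c j) (Polynomial.monom 1 (k j) * 1)"
        by (simp add: Polynomial.smult_monom)
      thus "pairing (log_seq n) (Polynomial.monom (c j) (k j)) = of_int (c j) * log_unit n j"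
        using log_k[OF \<open>odd j\<close>] by (simp only: pairing_smult pairing_monom_mult pairing_one) simp
    qed
    finally show ?thesis .
  qed
  ultimately have const: "Polynomial.coeff p i = Polynomial.coeff p 0" if "i < 2 ^ (n - 2)" for i
    using log_seq_relation_constant[OF n deg _ that] by simp
  have pow: "(4::int) \<le> 2 ^ (n - 1)"
    using power_increasing[of 2 "n - 1" "2::int"] n by simp
  \<comment> \<open>the odd index below \<open>2^(n-1)\<close> that does not occur in the relation\<close>
  define top :: int where "top = 2 ^ (n - 1) - 1"
  have top: "odd top" "1 \<le> top" "top < 2 ^ (n - 1)" using pow n by (auto simp: top_def)
  have "Polynomial.coeff p (k top) = 0"
    unfolding p_def Polynomial.coeff_sum
  proof (intro sum.neutral ballI)
    fix i assume "i \<in> J"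
    hence "k i \<noteq> k top" using inj[of i top] top by (auto simp: J_def top_def)
    thus "Polynomial.coeff (Polynomial.monom (c i) (k i)) (k top) = 0" by simp
  qed
  moreover have "j \<in> J" using j by (simp add: J_def)
  ultimately show ?thesis using const[of "k top"] const[of "k j"] k top j coeff by metis
qed

section \<open>Subgroups with a multiplicative basis\<close>

definition power_prod :: "'i set \<Rightarrow> ('i \<Rightarrow> complex) \<Rightarrow> ('i \<Rightarrow> int) \<Rightarrow> complex"
  where "power_prod I b c = (\<Prod>i\<in>I. b i powi c i)"

definition mult_independent :: "'i set \<Rightarrow> ('i \<Rightarrow> complex) \<Rightarrow> bool"
  where "mult_independent I b \<longleftrightarrow> (\<forall>c. power_prod I b c = 1 \<longrightarrow> (\<forall>i\<in>I. c i = 0))"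

lemma power_prod_0 [simp]: "power_prod I b (\<lambda>_. 0) = 1"
  by (simp add: power_prod_def)

lemma power_prod_add:
  "(\<And>i. i \<in> I \<Longrightarrow> b i \<noteq> 0) \<Longrightarrow> power_prod I b (\<lambda>i. c i + c' i) = power_prod I b c * power_prod I b c'"
  by (simp add: power_prod_def power_int_add prod.distrib)

lemma power_prod_uminus: "power_prod I b (\<lambda>i. - c i) = inverse (power_prod I b c)"
  using prod_inversef[of "\<lambda>i. b i powi c i" I] by (simp add: power_prod_def power_int_minus o_def)

lemma power_prod_diff:
  "(\<And>i. i \<in> I \<Longrightarrow> b i \<noteq> 0) \<Longrightarrow> power_prod I b (\<lambda>i. c i - c' i) = power_prod I b c * inverse (power_prod I b c')"
  using power_prod_add[of I b c "\<lambda>i. - c' i"] by (simp add: power_prod_uminus)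

lemma power_prod_power: "power_prod I b c ^ m = power_prod I b (\<lambda>i. int m * c i)"
proof -
  have "(b i powi c i) ^ m = b i powi (int m * c i)" for i
    by (metis mult.commute power_int_mult power_int_of_nat)
  thus ?thesis by (simp add: power_prod_def prod_power_distrib)
qed

lemma power_prod_powers: "power_prod I (\<lambda>i. b i ^ e i) c = power_prod I b (\<lambda>i. int (e i) * c i)"
  unfolding power_prod_def by (simp add: power_int_power)

lemma power_prod_single:
  assumes "finite I" "i \<in> I" shows "power_prod I b (\<lambda>i'. if i' = i then m else 0) = b i powi m"
proof -
  have "power_prod I b (\<lambda>i'. if i' = i then m else 0) = (\<Prod>i'\<in>I. if i' = i then b i powi m else 1)"
    unfolding power_prod_def by (intro prod.cong) auto
  thus ?thesis using assms by simp
qed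

lemma mult_independentD:
  assumes "mult_independent I b" "\<And>i. i \<in> I \<Longrightarrow> b i \<noteq> 0" "power_prod I b c = power_prod I b c'" "i \<in> I"
  shows "c i = c' i"
proof -
  have "power_prod I b c' \<noteq> 0"
    using assms(2) by (cases "finite I") (auto simp: power_prod_def)
  hence "power_prod I b (\<lambda>i. c i - c' i) = 1" using assms by (simp add: power_prod_diff)
  thus ?thesis using assms unfolding mult_independent_def by fastforce
qed

lemma prod_powi: "x \<noteq> 0 \<Longrightarrow> (\<Prod>i\<in>S. (x :: complex) powi c i) = x powi (\<Sum>i\<in>S. c i)"
  by (induction S rule: infinite_finite_induct) (auto simp: power_int_add)

lemma power_prod_reindex:
  assumes "finite I" "finite J" "h ` I \<subseteq> J" "\<And>j. j \<in> J \<Longrightarrow> g j \<noteq> 0"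
  shows "power_prod I (\<lambda>i. g (h i)) c = power_prod J g (\<lambda>j. \<Sum>i\<in>{i\<in>I. h i = j}. c i)"
proof -
  have "power_prod I (\<lambda>i. g (h i)) c = (\<Prod>j\<in>J. \<Prod>i\<in>{i\<in>I. h i = j}. g (h i) powi c i)"
    unfolding power_prod_def using assms(1-3) by (rule prod.group[symmetric])
  also have "\<dots> = power_prod J g (\<lambda>j. \<Sum>i\<in>{i\<in>I. h i = j}. c i)"
    unfolding power_prod_def
  proof (intro prod.cong refl)
    fix j assume "j \<in> J"
    have "(\<Prod>i\<in>{i\<in>I. h i = j}. g (h i) powi c i) = (\<Prod>i\<in>{i\<in>I. h i = j}. g j powi c i)"
      by (intro prod.cong) auto
    also have "\<dots> = g j powi (\<Sum>i\<in>{i\<in>I. h i = j}. c i)"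
      using assms(4)[OF \<open>j \<in> J\<close>]
      by (rule prod_powi)
    finally show "(\<Prod>i\<in>{i\<in>I. h i = j}. g (h i) powi c i) = g j powi (\<Sum>i\<in>{i\<in>I. h i = j}. c i)" .
  qed
  finally show ?thesis .
qed

text \<open>
  A relation among the \<open>b i\<close> with a nonzero exponent has one for which \<open>\<tau> i\<close> is maximal; the
  element \<open>g (\<tau> i)\<close> cannot be cancelled by any other factor. The exponent \<open>\<kappa> i = 0\<close> covers basis
  elements that are not modified.
\<close>

lemma mult_independent_unitriangular:
  fixes \<tau> \<rho> :: "'i \<Rightarrow> 'j :: linorder"
  assumes fin: "finite I" "finite J" and nz: "\<And>j. j \<in> J \<Longrightarrow> g j \<noteq> 0"
    and indep: "mult_independent J g"
    and tau: "inj_on \<tau> I" "\<tau> ` I \<subseteq> J" and rho: "\<rho> ` I \<subseteq> J"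
    and less: "\<And>i. i \<in> I \<Longrightarrow> \<kappa> i \<noteq> 0 \<Longrightarrow> \<rho> i < \<tau> i"
    and b: "\<And>i. i \<in> I \<Longrightarrow> b i = g (\<tau> i) * g (\<rho> i) powi \<kappa> i"
  shows "mult_independent I b"
  unfolding mult_independent_def
proof (intro allI impI)
  fix c assume 1: "power_prod I b c = 1"
  define s where "s j = (\<Sum>i\<in>{i\<in>I. \<tau> i = j}. c i)" for j
  define r where "r j = (\<Sum>i\<in>{i\<in>I. \<rho> i = j}. \<kappa> i * c i)" for j
  have "power_prod I b c = power_prod I (\<lambda>i. g (\<tau> i)) c * power_prod I (\<lambda>i. g (\<rho> i)) (\<lambda>i. \<kappa> i * c i)"
    unfolding power_prod_def prod.distrib[symmetric]
    by (intro prod.cong refl) (simp add: b power_int_mult_distrib power_int_mult)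
  also have "\<dots> = power_prod J g s * power_prod J g r"
    unfolding s_def r_def using fin tau rho nz by (simp add: power_prod_reindex)
  also have "\<dots> = power_prod J g (\<lambda>j. s j + r j)" using nz by (simp add: power_prod_add)
  finally have zero: "s j + r j = 0" if "j \<in> J" for j
    using indep that 1 unfolding mult_independent_def by auto
  show "\<forall>i\<in>I. c i = 0"
  proof (rule ccontr)
    assume "\<not> ?thesis"
    hence ne: "{i\<in>I. c i \<noteq> 0} \<noteq> {}" by blast
    moreover have finI: "finite {i\<in>I. c i \<noteq> 0}" using fin by simp
    ultimately obtain i where i: "i \<in> I" "c i \<noteq> 0" and max: "\<And>i'. i' \<in> I \<Longrightarrow> c i' \<noteq> 0 \<Longrightarrow> \<tau> i' \<le> \<tau> i"
      using Max_in[of "\<tau> ` {i\<in>I. c i \<noteq> 0}"] Max_ge[of "\<tau> ` {i\<in>I. c i \<noteq> 0}"] by fastforce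
    have "{i'\<in>I. \<tau> i' = \<tau> i} = {i}" using tau(1) i(1) by (auto dest: inj_onD)
    hence "s (\<tau> i) = c i" by (simp add: s_def)
    moreover have "r (\<tau> i) = 0" unfolding r_def
    proof (intro sum.neutral ballI)
      fix i' assume i': "i' \<in> {i'\<in>I. \<rho> i' = \<tau> i}"
      show "\<kappa> i' * c i' = 0"
        using less[of i'] max[of i'] i' by force
    qed
    moreover have "\<tau> i \<in> J" using tau i by blast
    ultimately show False using zero[of "\<tau> i"] i(2) by simp
  qed
qed

text \<open>
  Groups of nonzero complex numbers under the usual operations, with any carrier. Powers, inverses
  and products in such a group can then be computed in the field of complex numbers.
\<close>

locale complex_mult_group = comm_group G for G :: "complex monoid" (structure) +
  assumes mult_eq: "x \<otimes> y = x * y" and one_eq: "\<one> = 1" and zero_notin: "0 \<notin> carrier G"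
begin

lemma nat_pow_eq: "x [^] (m :: nat) = x ^ m"
  by (induction m) (simp_all add: mult_eq one_eq)

lemma pow_carrier: "x \<in> carrier G \<Longrightarrow> x ^ m \<in> carrier G"
  using nat_pow_closed by (simp add: nat_pow_eq)

lemma inv_eq: "x \<in> carrier G \<Longrightarrow> inv x = inverse x"
  using l_inv[of x] zero_notin by (metis inverse_unique mult.commute mult_eq one_eq)

lemma powi_in_subgroup:
  assumes "subgroup H G" "x \<in> H" shows "x powi m \<in> H"
proof -
  have nat: "y ^ k \<in> H" if "y \<in> H" for y k
    using that subgroup.one_closed[OF assms(1)] subgroup.m_closed[OF assms(1)]
    by (induction k) (simp_all add: one_eq mult_eq)
  have "inverse x \<in> H"
    using assms by (metis inv_eq subgroup.m_inv_closed subgroup.mem_carrier)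
  thus ?thesis using nat assms(2) by (auto simp: power_int_def)
qed

lemma prod_in_subgroup:
  assumes "subgroup H G" "\<And>i. i \<in> I \<Longrightarrow> f i \<in> H" shows "prod f I \<in> H"
  using assms(2) subgroup.one_closed[OF assms(1)] subgroup.m_closed[OF assms(1)]
  by (induction I rule: infinite_finite_induct) (auto simp: one_eq mult_eq)

lemma generate_eq_power_prods:
  assumes fin: "finite I" and b: "\<And>i. i \<in> I \<Longrightarrow> b i \<in> carrier G"
  shows "generate G (b ` I) = range (power_prod I b)"
proof (intro equalityI subsetI)
  have nz: "b i \<noteq> 0" if "i \<in> I" for i using b[OF that] zero_notin by auto
  fix x assume "x \<in> generate G (b ` I)"
  thus "x \<in> range (power_prod I b)"
  proof (induction rule: generate.induct)
    case one
    show ?case by (metis one_eq power_prod_0 rangeI)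
  next
    case (incl h)
    then obtain i where "i \<in> I" "h = b i" by blast
    hence "h = power_prod I b (\<lambda>i'. if i' = i then 1 else 0)" using fin by (simp add: power_prod_single)
    thus ?case by blast
  next
    case (inv h)
    then obtain i where "i \<in> I" "h = b i" by blast
    hence "inv h = power_prod I b (\<lambda>i'. if i' = i then - 1 else 0)"
      using fin b by (simp add: power_prod_single inv_eq power_int_minus)
    thus ?case by blast
  next
    case (eng x y)
    then obtain c c' where "x = power_prod I b c" "y = power_prod I b c'" by blast
    hence "x \<otimes> y = power_prod I b (\<lambda>i. c i + c' i)" using nz by (simp add: power_prod_add mult_eq)
    thus ?case by blast
  qed
next
  fix x assume "x \<in> range (power_prod I b)"
  then obtain c where x: "x = power_prod I b c" by blast
  have "subgroup (generate G (b ` I)) G" using b by (intro generate_is_subgroup) auto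
  thus "x \<in> generate G (b ` I)" unfolding x power_prod_def
    by (intro prod_in_subgroup powi_in_subgroup) (auto intro: generate.incl)
qed

end

lemma (in group) generate_UN_generate:
  assumes "\<And>i. i \<in> I \<Longrightarrow> X i \<subseteq> carrier G"
  shows "generate G (\<Union>i\<in>I. generate G (X i)) = generate G (\<Union>i\<in>I. X i)"
proof
  have sub: "subgroup (generate G (\<Union>i\<in>I. X i)) G" using assms by (intro generate_is_subgroup) auto
  show "generate G (\<Union>i\<in>I. generate G (X i)) \<subseteq> generate G (\<Union>i\<in>I. X i)"
    by (intro generate_subgroup_incl[OF _ sub] UN_least mono_generate UN_upper)
  show "generate G (\<Union>i\<in>I. X i) \<subseteq> generate G (\<Union>i\<in>I. generate G (X i))"
    by (intro mono_generate) (auto intro: generate.incl)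
qed

text \<open>
  The numbers \<open>f i\<close> are the exponents that generate the square root of the subgroup spanned by the
  powers \<open>b i ^ span_exp i\<close>. For \<open>i\<close> outside \<open>K\<close> the exponent \<open>1\<close> cannot be halved; the indices in \<open>K\<close> are those that contribute to the quotient.
\<close>

locale free_basis = complex_mult_group G for G :: "complex monoid" (structure) +
  fixes I K :: "'i set" and b :: "'i \<Rightarrow> complex" and f :: "'i \<Rightarrow> nat"
  assumes fin: "finite I" and b_carrier: "\<And>i. i \<in> I \<Longrightarrow> b i \<in> carrier G"
    and indep: "mult_independent I b"
    and K: "K \<subseteq> I" and f_pos: "\<And>i. i \<in> K \<Longrightarrow> f i > 0" and f_outside: "\<And>i. i \<in> I - K \<Longrightarrow> f i = 1"
begin

definition span_exp :: "'i \<Rightarrow> nat" where "span_exp i = (if i \<in> K then 2 * f i else 1)"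

definition "basis_span = generate G (b ` I)"
definition "power_span = generate G ((\<lambda>i. b i ^ span_exp i) ` I)"
definition "root_span = {x \<in> basis_span. x ^ 2 \<in> power_span}"

lemma b_nonzero: "i \<in> I \<Longrightarrow> b i \<noteq> 0"
  using b_carrier zero_notin by metis

lemma b_pow_carrier: "i \<in> I \<Longrightarrow> b i ^ m \<in> carrier G"
  using b_carrier pow_carrier by simp

lemma basis_span_eq: "basis_span = range (power_prod I b)"
  unfolding basis_span_def using fin b_carrier by (rule generate_eq_power_prods)

lemma subgroup_basis_span: "subgroup basis_span G"
  unfolding basis_span_def using b_carrier by (intro generate_is_subgroup) auto

lemma subgroup_power_span: "subgroup power_span G"
  unfolding power_span_def using b_pow_carrier by (intro generate_is_subgroup) auto

lemma power_span_eq: "power_span = range (\<lambda>c. power_prod I b (\<lambda>i. int (span_exp i) * c i))"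
  unfolding power_span_def power_prod_powers[symmetric]
  using fin b_pow_carrier by (rule generate_eq_power_prods)

text \<open>
  Independence makes membership a condition on the coordinates.
\<close>

lemma mem_power_span_iff: "power_prod I b c \<in> power_span \<longleftrightarrow> (\<forall>i\<in>I. int (span_exp i) dvd c i)"
proof
  assume "power_prod I b c \<in> power_span"
  then obtain c' where "power_prod I b c = power_prod I b (\<lambda>i. int (span_exp i) * c' i)"
    unfolding power_span_eq by blast
  thus "\<forall>i\<in>I. int (span_exp i) dvd c i"
    using mult_independentD[OF indep b_nonzero, where c = c and c' = "\<lambda>i. int (span_exp i) * c' i"] by auto
next
  assume "\<forall>i\<in>I. int (span_exp i) dvd c i"
  hence "power_prod I b c = power_prod I b (\<lambda>i. int (span_exp i) * (c i div int (span_exp i)))"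
    unfolding power_prod_def by (intro prod.cong) auto
  thus "power_prod I b c \<in> power_span"
    unfolding power_span_eq by (rule range_eqI[where x = "\<lambda>i. c i div int (span_exp i)"])
qed

lemma root_span_eq_range: "root_span = range (\<lambda>c. power_prod I b (\<lambda>i. int (f i) * c i))"
proof (intro equalityI subsetI)
  fix x assume x: "x \<in> root_span"
  then obtain c where c: "x = power_prod I b c" unfolding root_span_def basis_span_eq by blast
  have "power_prod I b (\<lambda>i. 2 * c i) = x ^ 2" by (simp add: c power_prod_power)
  hence "power_prod I b (\<lambda>i. 2 * c i) \<in> power_span" using x unfolding root_span_def by simp
  hence "int (span_exp i) dvd 2 * c i" if "i \<in> I" for i using that unfolding mem_power_span_iff by blast
  hence "int (f i) dvd c i" if "i \<in> I" for i
    using that f_outside[of i] by (cases "i \<in> K") (fastforce simp: span_exp_def)+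
  hence "x = power_prod I b (\<lambda>i. int (f i) * (c i div int (f i)))"
    unfolding c power_prod_def by (intro prod.cong) auto
  thus "x \<in> range (\<lambda>c. power_prod I b (\<lambda>i. int (f i) * c i))"
    by (rule range_eqI[where x = "\<lambda>i. c i div int (f i)"])
next
  fix x assume "x \<in> range (\<lambda>c. power_prod I b (\<lambda>i. int (f i) * c i))"
  then obtain c where x: "x = power_prod I b (\<lambda>i. int (f i) * c i)" by blast
  have "x ^ 2 = power_prod I b (\<lambda>i. 2 * (int (f i) * c i))" unfolding x power_prod_power by simp
  also have "\<dots> \<in> power_span" unfolding mem_power_span_iff by (auto simp: span_exp_def)
  finally show "x \<in> root_span" unfolding root_span_def basis_span_eq using x by blast
qed

lemma root_span_eq: "root_span = generate G ((\<lambda>i. b i ^ f i) ` I)"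
  unfolding root_span_eq_range power_prod_powers[symmetric]
  using fin b_pow_carrier by (rule generate_eq_power_prods[symmetric])

lemma subgroup_root_span: "subgroup root_span G"
  unfolding root_span_eq using b_pow_carrier by (intro generate_is_subgroup) auto

lemma power_span_subset_root_span: "power_span \<subseteq> root_span"
proof
  fix x assume x: "x \<in> power_span"
  hence "x \<in> basis_span" unfolding power_span_eq basis_span_eq by blast
  moreover have "x ^ 2 \<in> power_span"
    using subgroup.m_closed[OF subgroup_power_span x x] by (simp add: mult_eq power2_eq_square)
  ultimately show "x \<in> root_span" by (simp add: root_span_def)
qed

definition "root_grp = G\<lparr>carrier := root_span\<rparr>"
definition "quot = root_grp Mod power_span"

lemma comm_group_root_grp: "comm_group root_grp"
proof (rule group.group_comm_groupI)
  show "group root_grp" unfolding root_grp_def using subgroup_root_span by (rule subgroup_imp_group)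
  show "x \<otimes>\<^bsub>root_grp\<^esub> y = y \<otimes>\<^bsub>root_grp\<^esub> x" for x y by (simp add: root_grp_def mult_eq)
qed

lemma normal_power_span: "power_span \<lhd> root_grp"
proof -
  interpret root_grp: comm_group root_grp by (rule comm_group_root_grp)
  have "subgroup power_span root_grp" unfolding root_grp_def
    using subgroup_power_span subgroup_root_span power_span_subset_root_span by (rule subgroup_incl)
  thus ?thesis by (rule root_grp.subgroup_imp_normal)
qed

lemma comm_group_quot: "comm_group quot"
  unfolding quot_def using comm_group_root_grp normal_power_span
  by (metis comm_group.abelian_FactGroup normal_imp_subgroup)

definition cls :: "complex \<Rightarrow> complex set" where "cls x = power_span #>\<^bsub>root_grp\<^esub> x"

lemma cls_hom: "group_hom root_grp quot cls"
proof -
  have "cls = (\<lambda>x. power_span #>\<^bsub>root_grp\<^esub> x)" by (simp add: cls_def fun_eq_iff)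
  moreover have "(\<lambda>x. power_span #>\<^bsub>root_grp\<^esub> x) \<in> hom root_grp quot"
    unfolding quot_def using normal_power_span by (rule normal.r_coset_hom_Mod)
  ultimately show ?thesis
    using comm_group_root_grp comm_group_quot
    by (simp add: group_hom_def group_hom_axioms_def comm_group_def)
qed

lemma carrier_quot: "carrier quot = cls ` root_span"
  unfolding quot_def FactGroup_def RCOSETS_def cls_def root_grp_def by auto

lemma cls_eq_one_iff:
  assumes "x \<in> root_span" shows "cls x = \<one>\<^bsub>quot\<^esub> \<longleftrightarrow> x \<in> power_span"
proof -
  interpret root_grp: comm_group root_grp by (rule comm_group_root_grp)
  have sub: "subgroup power_span root_grp" using normal_power_span by (rule normal_imp_subgroup)
  have "x \<in> carrier root_grp" using assms by (simp add: root_grp_def)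
  hence "power_span #>\<^bsub>root_grp\<^esub> x = power_span \<longleftrightarrow> x \<in> power_span"
    using root_grp.coset_join1[OF _ _ sub] root_grp.coset_join2[OF _ sub] subgroup.subset[OF sub] by blast
  thus ?thesis by (simp add: cls_def quot_def)
qed

lemma inverse_in_root_span: "x \<in> root_span \<Longrightarrow> inverse x \<in> root_span"
  using powi_in_subgroup[OF subgroup_root_span, of x "-1"] by simp

lemma cls_eq_iff:
  assumes "x \<in> root_span" "y \<in> root_span" shows "cls x = cls y \<longleftrightarrow> x * inverse y \<in> power_span"
proof -
  interpret group_hom root_grp quot cls by (rule cls_hom)
  have mem: "x \<in> carrier root_grp" "y \<in> carrier root_grp" "inverse y \<in> carrier root_grp"
    using assms inverse_in_root_span by (simp_all add: root_grp_def)
  have y0: "y \<noteq> 0" using assms(2) subgroup.subset[OF subgroup_root_span] zero_notin by blast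
  have mult: "u \<otimes>\<^bsub>root_grp\<^esub> v = u * v" for u v by (simp add: root_grp_def mult_eq)
  have cls_mult: "cls (u * v) = cls u \<otimes>\<^bsub>quot\<^esub> cls v" if "u \<in> carrier root_grp" "v \<in> carrier root_grp" for u v
    using hom_mult[OF that] unfolding mult .
  have prod: "x * inverse y \<in> root_span"
    using G.m_closed[OF mem(1,3)] unfolding mult by (simp add: root_grp_def)
  have inv: "cls y \<otimes>\<^bsub>quot\<^esub> cls (inverse y) = \<one>\<^bsub>quot\<^esub>"
    using cls_mult[OF mem(2,3)] y0 hom_one by (simp add: root_grp_def one_eq)
  have "cls x = cls y \<longleftrightarrow> cls x \<otimes>\<^bsub>quot\<^esub> cls (inverse y) = cls y \<otimes>\<^bsub>quot\<^esub> cls (inverse y)"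
    using mem by (simp add: H.right_cancel)
  also have "\<dots> \<longleftrightarrow> cls (x * inverse y) = \<one>\<^bsub>quot\<^esub>"
    unfolding inv cls_mult[OF mem(1,3)] ..
  finally show ?thesis using cls_eq_one_iff[OF prod] by simp
qed

lemma generate_quot:
  assumes "X \<subseteq> root_span" shows "generate quot (cls ` X) = cls ` generate G X"
proof -
  have "generate quot (cls ` X) = cls ` generate root_grp X"
    by (rule group_hom.generate_img[OF cls_hom]) (use assms in \<open>simp add: root_grp_def\<close>)
  also have "generate root_grp X = generate G X"
    unfolding root_grp_def using assms subgroup_root_span by (rule generate_consistent)
  finally show ?thesis .
qed

lemma root_in_root_span: "i \<in> I \<Longrightarrow> b i ^ f i \<in> root_span"
  unfolding root_span_eq by (intro generate.incl) auto

lemma elementary_abelian_quot: "elementary_abelian 2 quot"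
  unfolding elementary_abelian_def
proof (intro conjI ballI impI)
  interpret quot: comm_group quot by (rule comm_group_quot)
  interpret group_hom root_grp quot cls by (rule cls_hom)
  show "comm_group quot" by (rule comm_group_quot)
  fix y assume y: "y \<in> carrier quot" "y \<noteq> \<one>\<^bsub>quot\<^esub>"
  then obtain x where x: "x \<in> root_span" "y = cls x" unfolding carrier_quot by blast
  have x2: "x \<otimes> x = x ^ 2" by (simp add: mult_eq power2_eq_square)
  have "x \<in> carrier root_grp" using x by (simp add: root_grp_def)
  hence "y \<otimes>\<^bsub>quot\<^esub> y = cls (x \<otimes>\<^bsub>root_grp\<^esub> x)" using x(2) by simp
  also have "x \<otimes>\<^bsub>root_grp\<^esub> x = x ^ 2" by (simp add: root_grp_def x2)
  also have "cls (x ^ 2) = \<one>\<^bsub>quot\<^esub>"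
  proof -
    have "x ^ 2 \<in> power_span" using x(1) by (simp add: root_span_def)
    thus ?thesis using power_span_subset_root_span cls_eq_one_iff by blast
  qed
  finally have "y [^]\<^bsub>quot\<^esub> (2 :: nat) = \<one>\<^bsub>quot\<^esub>"
    using y(1) by (simp add: numeral_2_eq_2)
  hence "quot.ord y dvd 2" using y(1) by (simp add: quot.pow_eq_id)
  moreover have "quot.ord y \<noteq> 1" using y quot.ord_eq_1 by blast
  ultimately show "quot.ord y = 2" using two_is_prime_nat prime_nat_iff by blast
qed

text \<open>
  In coordinates the quotient is the product over \<open>K\<close> of the groups \<open>f i \<int> / 2 f i \<int>\<close>. For the
  intersection condition, let a power of \<open>b i ^ f i\<close> and an element without \<open>b i\<close> represent the
  same coset. Comparing exponents at \<open>i\<close> shows that the power is even, so the coset is trivial.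
\<close>

lemma internal_direct_product_quot:
  "internal_direct_product quot K (\<lambda>i. generate quot {cls (b i ^ f i)})"
  unfolding internal_direct_product_def
proof (intro conjI ballI)
  interpret quot: comm_group quot by (rule comm_group_quot)
  have rootK: "b i ^ f i \<in> root_span" if "i \<in> K" for i using root_in_root_span K that by blast
  have cls_carrier: "{cls (b i ^ f i)} \<subseteq> carrier quot" if "i \<in> K" for i
    unfolding carrier_quot using rootK[OF that] by blast
  show "generate quot {cls (b i ^ f i)} \<lhd> quot" if "i \<in> K" for i
    using cls_carrier[OF that] by (intro quot.subgroup_imp_normal quot.generate_is_subgroup)
  have gen: "generate quot (\<Union>i\<in>L. generate quot {cls (b i ^ f i)})
      = cls ` range (power_prod L (\<lambda>i. b i ^ f i))" if L: "L \<subseteq> K" for L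
  proof -
    have "generate quot (\<Union>i\<in>L. generate quot {cls (b i ^ f i)}) = generate quot (\<Union>i\<in>L. {cls (b i ^ f i)})"
      using cls_carrier L by (intro quot.generate_UN_generate) blast
    also have "(\<Union>i\<in>L. {cls (b i ^ f i)}) = cls ` ((\<lambda>i. b i ^ f i) ` L)" by auto
    also have "generate quot \<dots> = cls ` generate G ((\<lambda>i. b i ^ f i) ` L)"
      using rootK L by (intro generate_quot) auto
    also have "generate G ((\<lambda>i. b i ^ f i) ` L) = range (power_prod L (\<lambda>i. b i ^ f i))"
      using L K b_pow_carrier fin by (intro generate_eq_power_prods) (auto intro: finite_subset)
    finally show ?thesis .
  qed
  show "carrier quot = generate quot (\<Union>i\<in>K. generate quot {cls (b i ^ f i)})"
    unfolding gen[OF order_refl]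
  proof (intro equalityI subsetI)
    fix y assume "y \<in> carrier quot"
    then obtain c where y: "y = cls (power_prod I b (\<lambda>i. int (f i) * c i))"
      unfolding carrier_quot root_span_eq_range by blast
    define c' where "c' i = (if i \<in> K then c i else 0)" for i
    have inS: "power_prod I b (\<lambda>i. int (f i) * c i) \<in> root_span" for c unfolding root_span_eq_range by blast
    have "y = cls (power_prod I b (\<lambda>i. int (f i) * c' i))" unfolding y
    proof (rule cls_eq_iff[THEN iffD2, OF inS inS])
      have "power_prod I b (\<lambda>i. int (f i) * c i) * inverse (power_prod I b (\<lambda>i. int (f i) * c' i))
          = power_prod I b (\<lambda>i. int (f i) * c i - int (f i) * c' i)"
        using b_nonzero by (simp add: power_prod_diff)
      also have "\<dots> \<in> power_span" unfolding mem_power_span_iff by (auto simp: c'_def span_exp_def)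
      finally show "power_prod I b (\<lambda>i. int (f i) * c i) * inverse (power_prod I b (\<lambda>i. int (f i) * c' i)) \<in> power_span" .
    qed
    also have "power_prod I b (\<lambda>i. int (f i) * c' i) = power_prod K (\<lambda>i. b i ^ f i) c"
      unfolding power_prod_powers[symmetric] unfolding power_prod_def
      using fin K by (intro prod.mono_neutral_cong_right) (auto simp: c'_def)
    finally show "y \<in> cls ` range (power_prod K (\<lambda>i. b i ^ f i))" by blast
  next
    fix y assume "y \<in> cls ` range (power_prod K (\<lambda>i. b i ^ f i))"
    then obtain c where "y = cls (power_prod K (\<lambda>i. b i ^ f i) c)" by blast
    moreover have "power_prod K (\<lambda>i. b i ^ f i) c \<in> root_span"
      unfolding power_prod_def by (intro prod_in_subgroup powi_in_subgroup subgroup_root_span rootK)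
    ultimately show "y \<in> carrier quot" unfolding carrier_quot by blast
  qed
  show "generate quot {cls (b i ^ f i)} \<inter> generate quot (\<Union>j\<in>K - {i}. generate quot {cls (b j ^ f j)}) = {\<one>\<^bsub>quot\<^esub>}"
    (is "?H \<inter> ?L = _") if i: "i \<in> K" for i
  proof (intro equalityI subsetI)
    fix y assume "y \<in> {\<one>\<^bsub>quot\<^esub>}"
    thus "y \<in> ?H \<inter> ?L" using generate.one by auto
  next
    fix y assume y: "y \<in> ?H \<inter> ?L"
    have "?H = generate quot (\<Union>j\<in>{i}. generate quot {cls (b j ^ f j)})"
      using quot.generate_UN_generate[of "{i}" "\<lambda>j. {cls (b j ^ f j)}"] cls_carrier[OF i] by simp
    also have "\<dots> = cls ` range (power_prod {i} (\<lambda>j. b j ^ f j))" using i by (intro gen) auto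
    finally obtain c where c: "y = cls (power_prod {i} (\<lambda>j. b j ^ f j) c)" using y by blast
    obtain c' where c': "y = cls (power_prod (K - {i}) (\<lambda>j. b j ^ f j) c')"
      using y gen[of "K - {i}"] by blast
    have inS: "power_prod L (\<lambda>j. b j ^ f j) c \<in> root_span" if "L \<subseteq> K" for L c
      unfolding power_prod_def using that by (intro prod_in_subgroup powi_in_subgroup subgroup_root_span rootK) auto
    define x where "x = power_prod {i} (\<lambda>j. b j ^ f j) c"
    define z where "z = power_prod (K - {i}) (\<lambda>j. b j ^ f j) c'"
    have xz: "x \<in> root_span" "z \<in> root_span" unfolding x_def z_def using i by (auto intro!: inS)
    define c2 where "c2 j = (if j = i then - c i else if j \<in> K then c' j else 0)" for j
    have nz: "b j ^ f j \<noteq> 0" if "j \<in> K" for j using b_nonzero K that by auto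
    have "power_prod I (\<lambda>j. b j ^ f j) c2 = power_prod K (\<lambda>j. b j ^ f j) c2"
      unfolding power_prod_def using fin K by (intro prod.mono_neutral_right) (auto simp: c2_def i)
    also have "\<dots> = (b i ^ f i) powi (- c i) * power_prod (K - {i}) (\<lambda>j. b j ^ f j) c2"
      unfolding power_prod_def using fin K i by (subst prod.remove[of K i]) (auto simp: c2_def intro: finite_subset)
    also have "power_prod (K - {i}) (\<lambda>j. b j ^ f j) c2 = z"
      unfolding z_def power_prod_def by (intro prod.cong) (auto simp: c2_def)
    also have "(b i ^ f i) powi (- c i) = inverse x" by (simp add: x_def power_prod_def power_int_minus)
    finally have eq: "power_prod I b (\<lambda>j. int (f j) * c2 j) = inverse x * z"
      by (simp add: power_prod_powers)
    have "z * inverse x \<in> power_span"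
      using cls_eq_iff[OF xz(2,1)] c c' by (simp add: x_def z_def)
    hence "inverse x * z \<in> power_span" by (simp add: mult.commute)
    hence "int (span_exp i) dvd int (f i) * c2 i" unfolding eq[symmetric] mem_power_span_iff using i K by blast
    hence "even (c i)" using i f_pos[OF i] by (auto simp: span_exp_def c2_def)
    hence "power_prod I b (\<lambda>j. int (f j) * (if j = i then c i else 0)) \<in> power_span"
      unfolding mem_power_span_iff using i by (auto simp: span_exp_def)
    also have "power_prod I b (\<lambda>j. int (f j) * (if j = i then c i else 0)) = x"
      using power_prod_single[of I i "\<lambda>j. b j ^ f j" "c i"] fin i K
      by (auto simp: power_prod_powers x_def power_prod_def power_int_power)
    finally have "cls x = \<one>\<^bsub>quot\<^esub>" using cls_eq_one_iff xz by blast
    thus "y \<in> {\<one>\<^bsub>quot\<^esub>}" using c by (simp add: x_def)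
  qed
qed

end

section \<open>The cyclotomic ring and congruences modulo 2\<close>

lemma Z_alpha_eq: "Z_alpha n = range (\<lambda>p. int_eval p (alpha n))"
  by (simp add: Z_alpha_def int_eval_def)

lemma Z_alpha_1: "1 \<in> Z_alpha n"
  unfolding Z_alpha_eq by (rule range_eqI[of _ _ 1]) simp

lemma Z_alpha_0: "0 \<in> Z_alpha n"
  unfolding Z_alpha_eq by (rule range_eqI[of _ _ 0]) simp

lemma Z_alpha_add: "x \<in> Z_alpha n \<Longrightarrow> y \<in> Z_alpha n \<Longrightarrow> x + y \<in> Z_alpha n"
  unfolding Z_alpha_eq by (auto simp flip: int_eval_add)

lemma Z_alpha_diff: "x \<in> Z_alpha n \<Longrightarrow> y \<in> Z_alpha n \<Longrightarrow> x - y \<in> Z_alpha n"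
  unfolding Z_alpha_eq by (auto simp flip: int_eval_diff)

lemma Z_alpha_mult: "x \<in> Z_alpha n \<Longrightarrow> y \<in> Z_alpha n \<Longrightarrow> x * y \<in> Z_alpha n"
  unfolding Z_alpha_eq by (auto simp flip: int_eval_mult)

lemma Z_alpha_uminus: "x \<in> Z_alpha n \<Longrightarrow> - x \<in> Z_alpha n"
  using Z_alpha_diff[OF Z_alpha_0, of x n] by simp

lemma Z_alpha_power: "x \<in> Z_alpha n \<Longrightarrow> x ^ m \<in> Z_alpha n"
  by (induction m) (simp_all add: Z_alpha_1 Z_alpha_mult)

lemma Z_alpha_sum: "(\<And>i. i \<in> S \<Longrightarrow> g i \<in> Z_alpha n) \<Longrightarrow> sum g S \<in> Z_alpha n"
  by (induction S rule: infinite_finite_induct) (simp_all add: Z_alpha_0 Z_alpha_add)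

lemma Z_alpha_powi: "alpha n powi a \<in> Z_alpha n"
proof -
  have "alpha n powi a = alpha n powi (a mod 2 ^ n)"
    by (rule alpha_powi_cong) (simp add: cong_def)
  also have "\<dots> = int_eval (Polynomial.monom 1 (nat (a mod 2 ^ n))) (alpha n)"
    by (simp flip: power_int_of_nat)
  finally show ?thesis unfolding Z_alpha_eq by blast
qed

lemma d_in_Z_alpha: "d n a \<in> Z_alpha n"
  unfolding d_def by (intro Z_alpha_add Z_alpha_1 Z_alpha_powi)

lemma comm_monoid_cyc_ring: "comm_monoid (cyc_ring n)"
  by (rule comm_monoidI) (auto simp: cyc_ring_def Z_alpha_1 intro: Z_alpha_mult)

lemma carrier_U: "carrier (U n) = {x \<in> Z_alpha n. \<exists>y\<in>Z_alpha n. x * y = 1}"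
  by (auto simp: units_of_def Units_def cyc_ring_def mult.commute)

lemma complex_mult_group_U: "complex_mult_group (U n)"
  unfolding complex_mult_group_def complex_mult_group_axioms_def
  using comm_monoid.units_comm_group[OF comm_monoid_cyc_ring, of n]
  by (auto simp: carrier_U) (simp_all add: units_of_def cyc_ring_def)

lemma d_in_U:
  assumes "n \<ge> 1" "odd a" shows "d n a \<in> carrier (U n)"
proof -
  obtain t where "d n a * (alpha n powi a * (\<Sum>i<t. (alpha n powi a) ^ (3 * i))) = 1"
    using d_inverse[OF assms] by blast
  moreover have "alpha n powi a * (\<Sum>i<t. (alpha n powi a) ^ (3 * i)) \<in> Z_alpha n"
    by (intro Z_alpha_mult Z_alpha_powi Z_alpha_sum Z_alpha_power)
  ultimately show ?thesis using d_in_Z_alpha unfolding carrier_U by blast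
qed

lemma cong2_iff: "cong2 n x y \<longleftrightarrow> (\<exists>z\<in>Z_alpha n. x = y + 2 * z)"
proof -
  have "x - y = 2 * z \<longleftrightarrow> x = y + 2 * z" for z by (auto simp: algebra_simps)
  thus ?thesis unfolding cong2_def by auto
qed

lemma cong2_refl: "cong2 n x x"
  unfolding cong2_iff using Z_alpha_0 by (intro bexI[of _ 0]) auto

lemma cong2_sym: "cong2 n x y \<Longrightarrow> cong2 n y x"
  unfolding cong2_iff by (auto intro!: bexI[OF _ Z_alpha_uminus])

lemma cong2_trans: "cong2 n x y \<Longrightarrow> cong2 n y z \<Longrightarrow> cong2 n x z"
proof -
  assume "cong2 n x y" "cong2 n y z"
  then obtain u v where "u \<in> Z_alpha n" "v \<in> Z_alpha n" "x = z + 2 * (u + v)"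
    unfolding cong2_iff by (auto simp: algebra_simps)
  thus ?thesis unfolding cong2_iff using Z_alpha_add by blast
qed

lemma cong2_mult:
  assumes "cong2 n x y" "cong2 n x' y'" "y \<in> Z_alpha n" "y' \<in> Z_alpha n"
  shows "cong2 n (x * x') (y * y')"
proof -
  obtain z z' where z: "z \<in> Z_alpha n" "x = y + 2 * z" "z' \<in> Z_alpha n" "x' = y' + 2 * z'"
    using assms(1,2) unfolding cong2_iff by blast
  have "x * x' = y * y' + 2 * (y * z' + z * y' + 2 * z * z')" using z by (simp add: algebra_simps)
  moreover have "y * z' + z * y' + 2 * z * z' \<in> Z_alpha n"
    unfolding mult_2 distrib_right by (intro Z_alpha_add Z_alpha_mult z assms)
  ultimately show ?thesis unfolding cong2_iff by blast
qed

text \<open>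
  Frobenius modulo \<open>2\<close>, based on the identity \<open>d(c)\<^sup>2 = d(2c) + 2 d(c)\<close>.
\<close>

lemma cong2_d_power: "cong2 n (d n a ^ (2 ^ k)) (d n (2 ^ k * a))"
proof (induction k)
  case 0
  show ?case by (simp add: cong2_refl)
next
  case (Suc k)
  have sq: "d n c ^ 2 = d n (2 * c) + 2 * d n c" for c
  proof -
    have x: "alpha n powi (2 * c) = (alpha n powi c) ^ 2" for c
      by (metis mult.commute power_int_mult power_int_numeral)
    have "alpha n powi (- (2 * c)) = (alpha n powi (- c)) ^ 2" using x[of "- c"] by simp
    moreover have "alpha n powi c * alpha n powi (- c) = 1" by (simp add: power_int_minus)
    ultimately show ?thesis unfolding d_def x by (simp add: power2_eq_square algebra_simps)
  qed
  have "cong2 n (d n a ^ 2 ^ k * d n a ^ 2 ^ k) (d n (2 ^ k * a) * d n (2 ^ k * a))"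
    using Suc.IH by (intro cong2_mult d_in_Z_alpha)
  moreover have "cong2 n (d n (2 ^ k * a) * d n (2 ^ k * a)) (d n (2 ^ Suc k * a))"
    using sq[of "2 ^ k * a"] d_in_Z_alpha
    unfolding cong2_iff by (auto simp: power2_eq_square mult.assoc)
  moreover have "d n a ^ 2 ^ Suc k = d n a ^ 2 ^ k * d n a ^ 2 ^ k"
    by (simp add: mult_2 power_add)
  ultimately show ?case using cong2_trans by metis
qed

text \<open>
  Here \<open>\<alpha>^(2^(n-1)) = -1\<close>, and signs do not matter modulo \<open>2\<close>.
\<close>

lemma cong2_d_antipode:
  assumes "n \<ge> 1" shows "cong2 n (d n (2 ^ (n - 1) - a)) (d n a)"
proof -
  have c: "alpha n powi (2 ^ (n - 1) + s) = - (alpha n powi s)" for s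
  proof -
    have "alpha n powi (2 ^ (n - 1)) = -1"
      using alpha_pow_half[OF assms] by (metis of_nat_numeral of_nat_power power_int_of_nat)
    thus ?thesis by (simp add: power_int_add)
  qed
  have "alpha n powi (a - 2 ^ (n - 1)) = - (alpha n powi a)"
    using c[of "a - 2 ^ (n - 1)"] by simp
  moreover have "alpha n powi (2 ^ (n - 1) - a) = - (alpha n powi (- a))" using c[of "- a"] by simp
  ultimately have "d n (2 ^ (n - 1) - a) = d n a + 2 * (1 - d n a)" by (simp add: d_def)
  thus ?thesis unfolding cong2_iff using Z_alpha_diff[OF Z_alpha_1 d_in_Z_alpha] by blast
qed

section \<open>A basis of D adapted to F\<close>

definition d_indices :: "nat \<Rightarrow> int set"
  where "d_indices n = {j. odd j \<and> 1 \<le> j \<and> j \<le> 2 ^ (n - 1) - 3}"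

text \<open>
  The pair \<open>(0, 1)\<close> is left out because \<open>q n 0 1\<close> would involve the unit of index
  \<open>2^(n-1) - 1\<close>, which is not among the generators of \<open>D n\<close>.
\<close>

definition basis_index :: "nat \<Rightarrow> (nat \<times> int) option set"
  where "basis_index n = insert None (Some ` (SIGMA k:{0..n - 3}. if k = 0 then A n 0 - {1} else A n k))"

fun basis_elt :: "nat \<Rightarrow> (nat \<times> int) option \<Rightarrow> complex"
  where "basis_elt n None = d n 1" | "basis_elt n (Some (k, j)) = q n k j"

fun root_exp :: "nat \<Rightarrow> (nat \<times> int) option \<Rightarrow> nat"
  where "root_exp n None = 2 ^ (n - 3)" | "root_exp n (Some (k, j)) = 2 ^ (k - 1)"

fun F_exp :: "nat \<Rightarrow> (nat \<times> int) option \<Rightarrow> nat"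
  where "F_exp n None = 2 ^ (n - 2)" | "F_exp n (Some (k, j)) = 2 ^ k"

text \<open>
  Basis element \<open>i\<close> is \<open>d n (upper_index n i)\<close> times a power of a \<open>d\<close> with smaller index. At
  \<open>None\<close> the exponent of that second factor is \<open>0\<close>, so any index in \<open>d_indices n\<close> would do as
  its lower index.
\<close>

fun upper_index :: "nat \<Rightarrow> (nat \<times> int) option \<Rightarrow> int"
  where "upper_index n None = 1" | "upper_index n (Some (k, j)) = 2 ^ (n - 1 - k) - j"

fun lower_index :: "(nat \<times> int) option \<Rightarrow> int"
  where "lower_index None = 1" | "lower_index (Some (k, j)) = j"

fun lower_exp :: "(nat \<times> int) option \<Rightarrow> int"
  where "lower_exp None = 0" | "lower_exp (Some _) = -1"

lemma finite_d_indices: "finite (d_indices n)"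
  by (rule finite_subset[of _ "{1..2 ^ (n - 1)}"]) (auto simp: d_indices_def)

lemma finite_A: "finite (A n k)"
  by (rule finite_subset[of _ "{1..2 ^ (n - 2 - k)}"]) (auto simp: A_def)

lemma finite_basis_index: "finite (basis_index n)"
  unfolding basis_index_def by (auto simp: finite_A)

lemma basis_index_cases:
  assumes n: "n \<ge> 4" and i: "i \<in> basis_index n"
  obtains "i = None"
  | k j where "i = Some (k, j)" "k \<le> n - 3" "j \<in> A n k" "k = 0 \<Longrightarrow> j \<ge> 3" "odd j" "1 \<le> j"
      "j < 2 ^ (n - 2 - k)" "(2 :: int) ^ (n - 1 - k) = 2 * 2 ^ (n - 2 - k)"
      "(2 :: int) ^ (n - 2 - k) \<ge> 2"
proof (cases i)
  case (Some p)
  obtain k j where p: "p = (k, j)" by force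
  have kj: "k \<le> n - 3" "j \<in> (if k = 0 then A n 0 - {1} else A n k)"
    using i unfolding basis_index_def Some p by auto
  hence jA: "j \<in> A n k" by (auto split: if_splits)
  have ge3: "j \<ge> 3" if "k = 0"
  proof -
    have "odd j" "1 \<le> j" "j \<noteq> 1" using kj(2) that by (auto simp: A_def)
    thus ?thesis by presburger
  qed
  have "n - 1 - k = Suc (n - 2 - k)" "n - 2 - k \<noteq> 0" using kj(1) n by auto
  hence "(2 :: int) ^ (n - 1 - k) = 2 * 2 ^ (n - 2 - k)" "(2 :: int) ^ (n - 2 - k) \<ge> 2 ^ 1"
    by (simp, intro power_increasing) auto
  thus ?thesis using that(2)[of k j] Some p kj(1) jA ge3 by (auto simp: A_def)
qed (use that in auto)

lemma pow_bound:
  assumes "n \<ge> 4" shows "(2::int) ^ (n - 1) = 2 * 2 ^ (n - 2)" "(4::int) \<le> 2 ^ (n - 2)"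
proof -
  have "n - 1 = Suc (n - 2)" using assms by simp
  thus "(2::int) ^ (n - 1) = 2 * 2 ^ (n - 2)" by simp
  show "(4::int) \<le> 2 ^ (n - 2)" using power_increasing[of 2 "n - 2" "2::int"] assms by simp
qed

lemma lower_index_in:
  assumes "n \<ge> 4" "i \<in> basis_index n" shows "lower_index i \<in> d_indices n"
  using assms
proof (cases rule: basis_index_cases)
  case 1
  thus ?thesis using pow_bound[OF assms(1)] by (simp add: d_indices_def)
next
  case (2 k j)
  have "(2::int) ^ (n - 2 - k) \<le> 2 ^ (n - 2)" by (intro power_increasing) auto
  hence "j \<le> 2 ^ (n - 1) - 3" using 2(7) pow_bound[OF assms(1)] by linarith
  thus ?thesis using 2(1,5,6) by (simp add: d_indices_def)
qed

lemma upper_index_in: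
  assumes "n \<ge> 4" "i \<in> basis_index n" shows "upper_index n i \<in> d_indices n"
  using assms
proof (cases rule: basis_index_cases)
  case 1
  thus ?thesis using pow_bound[OF assms(1)] by (simp add: d_indices_def)
next
  case (2 k j)
  have "2 ^ (n - 1 - k) - j \<le> (2::int) ^ (n - 1) - 3"
  proof (cases "k = 0")
    case True
    thus ?thesis using 2 by simp
  next
    case False
    hence "(2::int) ^ (n - 1 - k) \<le> 2 ^ (n - 2)" by (intro power_increasing) auto
    thus ?thesis using 2(6) pow_bound[OF assms(1)] by linarith
  qed
  moreover have "odd (2 ^ (n - 1 - k) - j)" using 2(5) unfolding 2(8) by simp
  moreover have "1 \<le> 2 ^ (n - 1 - k) - j" using 2(7,9) unfolding 2(8) by linarith
  ultimately show ?thesis using 2(1) by (simp add: d_indices_def)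
qed

lemma lower_less_upper:
  assumes "n \<ge> 4" "i \<in> basis_index n" "lower_exp i \<noteq> 0" shows "lower_index i < upper_index n i"
  using assms(1,2)
proof (cases rule: basis_index_cases)
  case (2 k j)
  thus ?thesis by simp
qed (use assms in auto)

lemma basis_elt_eq:
  assumes "n \<ge> 4" "i \<in> basis_index n"
  shows "basis_elt n i = d n (upper_index n i) * d n (lower_index i) powi lower_exp i"
  using assms
proof (cases rule: basis_index_cases)
  case (2 k j)
  interpret complex_mult_group "U n" by (rule complex_mult_group_U)
  have "d n j \<in> carrier (U n)" using 2 assms by (intro d_in_U) auto
  thus ?thesis using 2(1) by (simp add: q_def inv_eq mult_eq power_int_minus mult.commute)
qed auto

lemma upper_index_bounds:
  assumes "n \<ge> 4" "Some (k, j) \<in> basis_index n"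
  shows "2 ^ (n - 2 - k) < upper_index n (Some (k, j))" "upper_index n (Some (k, j)) < 2 ^ (n - 1 - k)"
    "k \<le> n - 3"
  by (use assms in \<open>cases rule: basis_index_cases; simp\<close>)+

text \<open>
  The index \<open>k\<close> is recovered from the dyadic interval that contains the upper index.
\<close>

lemma inj_on_upper_index:
  assumes n: "n \<ge> 4" shows "inj_on (upper_index n) (basis_index n)"
proof (rule inj_onI)
  have gt: "upper_index n (Some (k, j)) > 1" if "Some (k, j) \<in> basis_index n" for k j
    using upper_index_bounds(1)[OF n that] one_le_power[of "2 :: int" "n - 2 - k"] by linarith
  have le: "k \<le> k'" if "Some (k, j) \<in> basis_index n" "Some (k', j') \<in> basis_index n"
    "upper_index n (Some (k, j)) = upper_index n (Some (k', j'))" for k j k' j'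
  proof (rule ccontr)
    assume "\<not> k \<le> k'"
    hence "(2::int) ^ (n - 1 - k) \<le> 2 ^ (n - 2 - k')" by (intro power_increasing) auto
    thus False using upper_index_bounds[OF n that(1)] upper_index_bounds[OF n that(2)] that(3) by linarith
  qed
  fix i i' assume i: "i \<in> basis_index n" "i' \<in> basis_index n" "upper_index n i = upper_index n i'"
  show "i = i'"
  proof (cases i)
    case None
    thus ?thesis using i gt by (cases i') force+
  next
    case (Some p)
    obtain k j where p: "p = (k, j)" by force
    obtain k' j' where i': "i' = Some (k', j')" using i gt Some p by (cases i') force+
    have "k = k'" using le[of k j k' j'] le[of k' j' k j] i Some p i' by auto
    thus ?thesis using i Some p i' by simp
  qed
qed

lemma upper_index_surj:
  assumes n: "n \<ge> 4" and j: "j \<in> d_indices n"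
  shows "\<exists>i\<in>basis_index n. upper_index n i = j"
proof (cases "j = 1")
  case True
  thus ?thesis by (intro bexI[of _ None]) (auto simp: basis_index_def)
next
  case False
  have odd: "odd j" "1 \<le> j" "j \<le> 2 ^ (n - 1) - 3" using j by (auto simp: d_indices_def)
  hence j3: "j \<ge> 3" using False by presburger
  have "1 \<le> nat j" using j3 by simp
  then obtain m where "2 ^ m \<le> nat j" "nat j < 2 ^ (m + 1)" using ex_power_ivl1[of 2 "nat j"] by blast
  hence m: "2 ^ m \<le> j" "j < 2 ^ Suc m"
    using j3 by (simp_all add: le_nat_iff nat_less_iff)
  have m1: "m \<ge> 1" using m j3 by (cases m) auto
  hence "even (2 ^ m :: int)" by simp
  hence "2 ^ m \<noteq> j" using odd(1) by metis
  hence lt: "2 ^ m < j" using m by simp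
  have "(2::int) ^ m < 2 ^ (n - 1)" using m(1) odd(3) by linarith
  hence mn: "m < n - 1" by (simp add: power_strict_increasing_iff)
  define k where "k = n - 2 - m"
  have k: "n - 2 - k = m" "n - 1 - k = Suc m" "k \<le> n - 3" using mn m1 by (auto simp: k_def)
  define j' where "j' = 2 ^ Suc m - j"
  have "odd j'" "1 \<le> j'" "j' \<le> 2 ^ m - 1" using odd(1) m lt by (auto simp: j'_def)
  hence "j' \<in> A n k" unfolding A_def k(1) by simp
  moreover have "j' \<noteq> 1" if "k = 0"
  proof -
    have "Suc m = n - 1" using k(2) that by simp
    thus ?thesis using odd(3) unfolding j'_def by simp
  qed
  ultimately have "Some (k, j') \<in> basis_index n" using k(3) by (auto simp: basis_index_def)
  moreover have "upper_index n (Some (k, j')) = j" unfolding upper_index.simps k(2) by (simp add: j'_def)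
  ultimately show ?thesis by blast
qed

lemma basis_elt_independent:
  assumes n: "n \<ge> 4" shows "mult_independent (basis_index n) (basis_elt n)"
proof (rule mult_independent_unitriangular)
  show "mult_independent (d_indices n) (d n)"
    unfolding mult_independent_def power_prod_def d_indices_def
    using d_multiplicatively_independent[of n] n by auto
  show "d n j \<noteq> 0" if "j \<in> d_indices n" for j
    using that n by (intro d_nonzero) (auto simp: d_indices_def)
qed (use n in \<open>auto simp: finite_basis_index finite_d_indices inj_on_upper_index upper_index_in
      lower_index_in lower_less_upper basis_elt_eq\<close>)

lemma d_indices_U: "n \<ge> 4 \<Longrightarrow> j \<in> d_indices n \<Longrightarrow> d n j \<in> carrier (U n)"
  by (rule d_in_U) (auto simp: d_indices_def)

lemma D_eq: "D n = generate (U n) (d n ` d_indices n)"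
proof -
  have "{d n j | j. odd j \<and> 1 \<le> j \<and> j \<le> 2 ^ (n - 1) - 3} = d n ` d_indices n"
    by (auto simp: d_indices_def)
  thus ?thesis by (simp add: D_def)
qed

lemma subgroup_D:
  assumes n: "n \<ge> 4" shows "subgroup (D n) (U n)"
proof -
  interpret complex_mult_group "U n" by (rule complex_mult_group_U)
  show ?thesis unfolding D_eq using d_indices_U[OF n] by (intro generate_is_subgroup) auto
qed

lemma basis_elt_in_D:
  assumes n: "n \<ge> 4" and i: "i \<in> basis_index n" shows "basis_elt n i \<in> D n"
proof -
  interpret complex_mult_group "U n" by (rule complex_mult_group_U)
  have sub: "subgroup (D n) (U n)" by (rule subgroup_D[OF n])
  have d: "d n j \<in> D n" if "j \<in> d_indices n" for j
    unfolding D_eq using that by (intro generate.incl) auto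
  show ?thesis unfolding basis_elt_eq[OF n i] mult_eq[symmetric]
    using upper_index_in[OF n i] lower_index_in[OF n i]
    by (intro subgroup.m_closed[OF sub] powi_in_subgroup[OF sub] d)
qed

text \<open>
  Each \<open>d n j\<close> is a basis element times a power of some \<open>d n j'\<close> with \<open>j' < j\<close>; induct on \<open>j\<close>.
\<close>

lemma D_eq_basis:
  assumes n: "n \<ge> 4" shows "D n = generate (U n) (basis_elt n ` basis_index n)"
proof
  interpret complex_mult_group "U n" by (rule complex_mult_group_U)
  have subD: "subgroup (D n) (U n)" by (rule subgroup_D[OF n])
  show "generate (U n) (basis_elt n ` basis_index n) \<subseteq> D n"
    using basis_elt_in_D[OF n] by (intro generate_subgroup_incl[OF _ subD]) auto
  have sub: "subgroup (generate (U n) (basis_elt n ` basis_index n)) (U n)" (is "subgroup ?B _")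
    using basis_elt_in_D[OF n] subgroup.subset[OF subD] by (intro generate_is_subgroup) auto
  have "j \<in> d_indices n \<Longrightarrow> d n j \<in> ?B" for j
  proof (induction "nat j" arbitrary: j rule: less_induct)
    case less
    obtain i where i: "i \<in> basis_index n" "upper_index n i = j"
      using upper_index_surj[OF n less.prems] by blast
    have bi: "basis_elt n i \<in> ?B" using i(1) by (intro generate.incl) auto
    show ?case
    proof (cases "lower_exp i = 0")
      case True
      thus ?thesis using basis_elt_eq[OF n i(1)] i(2) bi by simp
    next
      case False
      have "lower_index i < j" using lower_less_upper[OF n i(1) False] i(2) by simp
      moreover have low: "lower_index i \<in> d_indices n" using lower_index_in[OF n i(1)] .
      ultimately have "d n (lower_index i) \<in> ?B"
        using less by (intro less.hyps) (auto simp: d_indices_def)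
      hence "basis_elt n i * d n (lower_index i) powi (- lower_exp i) \<in> ?B"
        unfolding mult_eq[symmetric] using bi
        by (intro subgroup.m_closed[OF sub] powi_in_subgroup[OF sub])
      moreover have "d n (lower_index i) \<noteq> 0" using low n by (intro d_nonzero) (auto simp: d_indices_def)
      hence "d n (lower_index i) powi lower_exp i \<noteq> 0" by simp
      ultimately show ?thesis using basis_elt_eq[OF n i(1)] i(2) by (simp add: power_int_minus mult.assoc)
    qed
  qed
  thus "D n \<subseteq> ?B" unfolding D_eq by (intro generate_subgroup_incl[OF _ sub]) auto
qed

lemma F_eq:
  assumes n: "n \<ge> 4" shows "F n = generate (U n) ((\<lambda>i. basis_elt n i ^ F_exp n i) ` basis_index n)"
proof -
  interpret complex_mult_group "U n" by (rule complex_mult_group_U)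
  have subD: "subgroup (D n) (U n)" by (rule subgroup_D[OF n])
  have bU: "basis_elt n i ^ m \<in> carrier (U n)" if "i \<in> basis_index n" for i m
    using basis_elt_in_D[OF n that] subgroup.subset[OF subD] nat_pow_closed nat_pow_eq by auto
  define B where "B k = (if k = 0 then A n 0 - {1} else A n k)" for k
  have qU: "{q n k j ^ 2 ^ k} \<subseteq> carrier (U n)" if "k \<in> {0..n - 3}" "j \<in> B k" for k j
    using bU[of "Some (k, j)" "2 ^ k"] that by (auto simp: basis_index_def B_def)
  have dU: "{d n 1 ^ 2 ^ (n - 2)} \<subseteq> carrier (U n)"
    using bU[of None "2 ^ (n - 2)"] by (auto simp: basis_index_def)
  have part: "F_part n k = generate (U n) (\<Union>j\<in>B k. {q n k j ^ 2 ^ k})" if "k \<in> {0..n - 3}" for k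
    unfolding F_part_def nat_pow_eq B_def[symmetric] using qU[OF that] by (rule generate_UN_generate)
  have "(\<Union>k\<in>{0..n - 3}. F_part n k) = (\<Union>k\<in>{0..n - 3}. generate (U n) (\<Union>j\<in>B k. {q n k j ^ 2 ^ k}))"
    using part by simp
  hence "F n = generate (U n) (generate (U n) {d n 1 ^ 2 ^ (n - 2)} \<union>
      (\<Union>k\<in>{0..n - 3}. generate (U n) (\<Union>j\<in>B k. {q n k j ^ 2 ^ k})))"
    by (simp add: F_def nat_pow_eq)
  also have "\<dots> = generate (U n) ({d n 1 ^ 2 ^ (n - 2)} \<union> (\<Union>k\<in>{0..n - 3}. \<Union>j\<in>B k. {q n k j ^ 2 ^ k}))"
  proof -
    let ?X = "\<lambda>o'. case o' of None \<Rightarrow> {d n 1 ^ 2 ^ (n - 2)} | Some k \<Rightarrow> (\<Union>j\<in>B k. {q n k j ^ 2 ^ k})"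
    have "generate (U n) (\<Union>o'\<in>insert None (Some ` {0..n - 3}). generate (U n) (?X o'))
        = generate (U n) (\<Union>o'\<in>insert None (Some ` {0..n - 3}). ?X o')"
      using qU dU by (intro generate_UN_generate) (auto split: option.splits)
    thus ?thesis by simp
  qed
  also have "{d n 1 ^ 2 ^ (n - 2)} \<union> (\<Union>k\<in>{0..n - 3}. \<Union>j\<in>B k. {q n k j ^ 2 ^ k})
      = (\<lambda>i. basis_elt n i ^ F_exp n i) ` basis_index n"
  proof -
    have "(\<lambda>i. basis_elt n i ^ F_exp n i) ` basis_index n
        = insert (d n 1 ^ 2 ^ (n - 2)) ((\<lambda>(k, j). q n k j ^ 2 ^ k) ` (SIGMA k:{0..n - 3}. B k))"
      unfolding basis_index_def B_def[symmetric] image_insert image_image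
      by (intro arg_cong2[of _ _ _ _ insert] image_cong) auto
    moreover have "(\<lambda>(k, j). q n k j ^ 2 ^ k) ` (SIGMA k:{0..n - 3}. B k)
        = (\<Union>k\<in>{0..n - 3}. \<Union>j\<in>B k. {q n k j ^ 2 ^ k})" by force
    ultimately show ?thesis by simp
  qed
  finally show ?thesis .
qed

lemma Q_index_subset: "Q_index n \<subseteq> basis_index n"
  unfolding Q_index_def basis_index_def by auto

lemma free_basis_U:
  assumes n: "n \<ge> 4"
  shows "free_basis (U n) (basis_index n) (Q_index n) (basis_elt n) (root_exp n)"
proof -
  interpret complex_mult_group "U n" by (rule complex_mult_group_U)
  have subD: "subgroup (D n) (U n)" by (rule subgroup_D[OF n])
  show ?thesis
  proof
    show "basis_elt n i \<in> carrier (U n)" if "i \<in> basis_index n" for i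
      using basis_elt_in_D[OF n that] subgroup.subset[OF subD] by blast
    show "root_exp n i > 0" for i by (cases "(n, i)" rule: root_exp.cases) auto
    show "root_exp n i = 1" if "i \<in> basis_index n - Q_index n" for i
      using that by (auto simp: basis_index_def Q_index_def split: if_splits)
  qed (use finite_basis_index basis_elt_independent[OF n] Q_index_subset in auto)
qed

lemma subgroup_E:
  assumes n: "n \<ge> 4" shows "subgroup (E n) (U n)"
proof -
  interpret complex_mult_group "U n" by (rule complex_mult_group_U)
  have sub_D: "subgroup (D n) (U n)" by (rule subgroup_D[OF n])
  show ?thesis
  proof (rule subgroupI)
    show "E n \<subseteq> carrier (U n)" using subgroup.subset[OF sub_D] by (auto simp: E_def)
    show "E n \<noteq> {}" using subgroup.one_closed[OF sub_D] cong2_refl by (auto simp: E_def one_eq)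
    fix x assume x: "x \<in> E n"
    hence xU: "x \<in> carrier (U n)" and xD: "x \<in> D n" and x1: "cong2 n x 1"
      using subgroup.subset[OF sub_D] by (auto simp: E_def)
    have inv: "inverse x \<in> carrier (U n)" using inv_closed[OF xU] inv_eq[OF xU] by simp
    have x0: "x \<noteq> 0" using xU zero_notin by auto
    have "cong2 n (x * inverse x) (1 * inverse x)"
      using inv by (intro cong2_mult x1 cong2_refl Z_alpha_1) (auto simp: carrier_U)
    hence "cong2 n (inverse x) 1" using x0 cong2_sym by simp
    thus "inv\<^bsub>U n\<^esub> x \<in> E n"
      using subgroup.m_inv_closed[OF sub_D xD] by (simp add: E_def inv_eq[OF xU])
    fix y assume y: "y \<in> E n"
    have "cong2 n (x * y) (1 * 1)" using x1 y by (intro cong2_mult Z_alpha_1) (auto simp: E_def)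
    thus "x \<otimes>\<^bsub>U n\<^esub> y \<in> E n"
      using subgroup.m_closed[OF sub_D xD, of y] y by (simp add: E_def mult_eq)
  qed
qed

lemma subgroup_D_pow:
  assumes n: "n \<ge> 4" shows "subgroup (D_pow n m) (U n)"
proof -
  interpret complex_mult_group "U n" by (rule complex_mult_group_U)
  have sub_D: "subgroup (D n) (U n)" by (rule subgroup_D[OF n])
  have Dp: "D_pow n m = {x ^ m |x. x \<in> D n}" by (simp add: D_pow_def nat_pow_eq)
  show ?thesis
  proof (rule subgroupI)
    show "D_pow n m \<subseteq> carrier (U n)"
      using subgroup.subset[OF sub_D] pow_carrier unfolding Dp by auto
    show "D_pow n m \<noteq> {}" using subgroup.one_closed[OF sub_D] unfolding Dp by blast
    fix x assume "x \<in> D_pow n m"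
    then obtain x' where x': "x' \<in> D n" "x = x' ^ m" unfolding Dp by blast
    have x'U: "x' \<in> carrier (U n)" using x' subgroup.subset[OF sub_D] by blast
    have "inv\<^bsub>U n\<^esub> x = (inv\<^bsub>U n\<^esub> x') ^ m"
      using x'U pow_carrier[OF x'U] by (simp add: x'(2) inv_eq power_inverse)
    thus "inv\<^bsub>U n\<^esub> x \<in> D_pow n m" using subgroup.m_inv_closed[OF sub_D x'(1)] unfolding Dp by blast
    fix y assume "y \<in> D_pow n m"
    then obtain y' where y': "y' \<in> D n" "y = y' ^ m" unfolding Dp by blast
    have "x \<otimes>\<^bsub>U n\<^esub> y = (x' \<otimes>\<^bsub>U n\<^esub> y') ^ m"
      by (simp add: x' y' mult_eq power_mult_distrib)
    thus "x \<otimes>\<^bsub>U n\<^esub> y \<in> D_pow n m" using subgroup.m_closed[OF sub_D x'(1) y'(1)] unfolding Dp by blast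
  qed
qed

text \<open>
  For \<open>d n 1\<close> the Frobenius leads to \<open>d n (2 ^ (n - 2)) = 1 + \<i> + 1 / \<i> = 1\<close>. For \<open>q n k j\<close> it
  leads to the quotient of the \<open>d\<close> at the antipodal indices \<open>2^(n-1) - 2^k j\<close> and \<open>2^k j\<close>.
\<close>

lemma cong2_F_generator:
  assumes n: "n \<ge> 4" and i: "i \<in> basis_index n"
  shows "cong2 n (basis_elt n i ^ F_exp n i) 1"
proof -
  interpret complex_mult_group "U n" by (rule complex_mult_group_U)
  show ?thesis using n i
  proof (cases rule: basis_index_cases)
    case 1
    have "n = Suc (Suc (n - 2))" using n by simp
    hence "(2::real) ^ n = 4 * 2 ^ (n - 2)" using power_add[of "2::real" 2 "n - 2"] by simp
    hence "real_unit n (2 ^ (n - 2)) = 1 + 2 * cos (pi / 2)"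
      unfolding real_unit_def by (simp add: field_simps)
    hence "d n (2 ^ (n - 2)) = 1" by (simp add: d_eq_real_unit)
    thus ?thesis using cong2_d_power[of n 1 "n - 2"] 1 by simp
  next
    case (2 k j)
    have dj: "d n j \<in> carrier (U n)" using 2 n by (intro d_in_U) auto
    let ?v = "d n j ^ 2 ^ k" and ?w = "d n (2 ^ (n - 1 - k) - j) ^ 2 ^ k"
    have "2 ^ k * (2 ^ (n - 1 - k) - j) = 2 ^ (n - 1) - 2 ^ k * j"
      using 2(2) n by (simp add: algebra_simps flip: power_add)
    hence "cong2 n ?w (d n (2 ^ (n - 1) - 2 ^ k * j))"
      using cong2_d_power[of n "2 ^ (n - 1 - k) - j" k] by simp
    moreover have "cong2 n (d n (2 ^ (n - 1) - 2 ^ k * j)) (d n (2 ^ k * j))"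
      using n by (intro cong2_d_antipode) simp
    ultimately have "cong2 n ?w ?v"
      by (rule cong2_trans[OF cong2_trans cong2_sym[OF cong2_d_power]])
    moreover have inv: "inverse ?v \<in> Z_alpha n"
      using inv_closed[OF dj] inv_eq[OF dj]
      by (auto simp: carrier_U power_inverse[symmetric] intro: Z_alpha_power)
    ultimately have "cong2 n (?w * inverse ?v) (?v * inverse ?v)"
      by (intro cong2_mult cong2_refl Z_alpha_power d_in_Z_alpha)
    moreover have "?v \<noteq> 0" using dj zero_notin by auto
    moreover have "basis_elt n i ^ F_exp n i = ?w * inverse ?v"
      using 2(1) by (simp add: q_def mult_eq inv_eq[OF dj] power_mult_distrib power_inverse mult.commute)
    ultimately show ?thesis by simp
  qed
qed

theorem mainTheorem5:
  fixes n :: nat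
  assumes "n \<ge> 4"
  shows "subgroup (sqrt_F n) (grp n (D n))
    \<and> (internal_direct_product (Q n) (Q_index n) (Q_factor n) \<and> elementary_abelian 2 (Q n))
    \<and> (proper_subgroup (D_pow n (2 ^ (n - 2))) (grp n (F n))
       \<and> subgroup (F n) (grp n (sqrt_F n \<inter> E n))
       \<and> subgroup (sqrt_F n \<inter> E n) (grp n (sqrt_F n))
       \<and> proper_subgroup (sqrt_F n) (grp n (D n)))"
proof -
  interpret FB: free_basis "U n" "basis_index n" "Q_index n" "basis_elt n" "root_exp n"
    by (rule free_basis_U[OF assms])
  have D: "FB.basis_span = D n" unfolding FB.basis_span_def D_eq_basis[OF assms] ..
  have e: "FB.span_exp i = F_exp n i" if "i \<in> basis_index n" for i
    using assms that
  proof (cases rule: basis_index_cases)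
    case 1
    have "n - 2 = Suc (n - 3)" using assms by simp
    moreover have "None \<in> Q_index n" by (simp add: Q_index_def)
    ultimately show ?thesis using 1 by (simp add: FB.span_exp_def)
  next
    case (2 k j)
    hence "i \<in> Q_index n \<longleftrightarrow> k \<noteq> 0" by (auto simp: Q_index_def)
    thus ?thesis using 2(1) by (cases k) (simp_all add: FB.span_exp_def)
  qed
  have F: "FB.power_span = F n" unfolding FB.power_span_def F_eq[OF assms] using e by simp
  have S: "FB.root_span = sqrt_F n" unfolding FB.root_span_def sqrt_F_def D F FB.nat_pow_eq ..
  have root_grp: "FB.root_grp = grp n (sqrt_F n)" unfolding FB.root_grp_def S ..
  have quot: "FB.quot = Q n" unfolding FB.quot_def Q_def root_grp F ..
  have cls: "FB.cls = coset n" by (simp add: FB.cls_def coset_def root_grp F fun_eq_iff)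
  have sub_D: "subgroup (D n) (U n)" using FB.subgroup_basis_span unfolding D .
  have sub_F: "subgroup (F n) (U n)" using FB.subgroup_power_span unfolding F .
  have sub_S: "subgroup (sqrt_F n) (U n)" using FB.subgroup_root_span unfolding S .
  have S_D: "sqrt_F n \<subseteq> D n" by (auto simp: sqrt_F_def)
  have F_S: "F n \<subseteq> sqrt_F n" using FB.power_span_subset_root_span unfolding F S .
  have sub_E: "subgroup (E n) (U n)" by (rule subgroup_E[OF assms])
  have F_E: "F n \<subseteq> E n"
    unfolding F_eq[OF assms]
  proof (rule FB.generate_subgroup_incl[OF _ sub_E], safe)
    fix i assume i: "i \<in> basis_index n"
    have bD: "basis_elt n i ^ F_exp n i \<in> D n"
      using F_S S_D generate.incl[of _ _ "U n"] i unfolding F_eq[OF assms] by blast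
    have "cong2 n (basis_elt n i ^ F_exp n i) 1" by (rule cong2_F_generator[OF assms i])
    thus "basis_elt n i ^ F_exp n i \<in> E n" using bD by (simp add: E_def)
  qed
  have "subgroup (sqrt_F n) (grp n (D n))" using sub_S sub_D S_D by (rule FB.subgroup_incl)
  moreover have "elementary_abelian 2 (Q n)" using FB.elementary_abelian_quot unfolding quot .
  moreover have "internal_direct_product (Q n) (Q_index n) (Q_factor n)"
  proof -
    have "Q_factor n i = generate (Q n) {coset n (basis_elt n i ^ root_exp n i)}" for i
      by (cases "(n, i)" rule: root_exp.cases) (auto simp: Q_factor_def FB.nat_pow_eq)
    hence "Q_factor n = (\<lambda>i. generate (Q n) {coset n (basis_elt n i ^ root_exp n i)})" by blast
    thus ?thesis using FB.internal_direct_product_quot unfolding quot cls by simp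
  qed
  moreover have "proper_subgroup (D_pow n (2 ^ (n - 2))) (grp n (F n))"
    unfolding proper_subgroup_def
  proof
    have Dp: "D_pow n m = {x ^ m |x. x \<in> D n}" for m by (simp add: D_pow_def FB.nat_pow_eq)
    have sub: "subgroup (D_pow n m) (U n)" for m by (rule subgroup_D_pow[OF assms])
    have "D_pow n (2 ^ (n - 2)) \<subseteq> F n"
    proof
      fix x assume "x \<in> D_pow n (2 ^ (n - 2))"
      then obtain c where "x = power_prod (basis_index n) (basis_elt n) c ^ 2 ^ (n - 2)"
        unfolding Dp D[symmetric] FB.basis_span_eq by blast
      hence x: "x = power_prod (basis_index n) (basis_elt n) (\<lambda>i. int (2 ^ (n - 2)) * c i)"
        by (simp add: power_prod_power)
      have "int (FB.span_exp i) dvd int (2 ^ (n - 2)) * c i" if "i \<in> basis_index n" for i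
        using assms that
      proof (cases rule: basis_index_cases)
        case 1
        thus ?thesis using e[OF that] by simp
      next
        case (2 k j)
        hence "(2::int) ^ k dvd 2 ^ (n - 2)" using assms by (intro le_imp_power_dvd) auto
        thus ?thesis using e[OF that] 2 by simp
      qed
      thus "x \<in> F n" unfolding x F[symmetric] FB.mem_power_span_iff by blast
    qed
    thus "subgroup (D_pow n (2 ^ (n - 2))) (grp n (F n))" by (rule FB.subgroup_incl[OF sub sub_F])
    \<comment> \<open>\<open>q(0,3)\<close> has exponent \<open>1\<close> in \<open>F\<close>; the index \<open>3\<close> is available because \<open>n \<ge> 4\<close>\<close>
    define i :: "(nat \<times> int) option" where "i = Some (0, 3)"
    have i: "i \<in> basis_index n"
      using pow_bound(2)[OF assms] by (auto simp: basis_index_def A_def i_def)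
    have "basis_elt n i ^ F_exp n i \<in> F n" unfolding F_eq[OF assms] using i by (intro generate.incl) auto
    hence "basis_elt n i \<in> F n" by (simp add: i_def)
    moreover have "basis_elt n i \<notin> D_pow n (2 ^ (n - 2))"
    proof
      assume "basis_elt n i \<in> D_pow n (2 ^ (n - 2))"
      then obtain c where c: "basis_elt n i = power_prod (basis_index n) (basis_elt n) c ^ 2 ^ (n - 2)"
        unfolding Dp D[symmetric] FB.basis_span_eq by blast
      have "power_prod (basis_index n) (basis_elt n) (\<lambda>i'. if i' = i then 1 else 0)
          = power_prod (basis_index n) (basis_elt n) (\<lambda>i. int (2 ^ (n - 2)) * c i)"
        using c i by (simp add: power_prod_single[OF FB.fin i] power_prod_power)
      from mult_independentD[OF FB.indep FB.b_nonzero this i]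
      have "1 = int (2 ^ (n - 2)) * c i" by simp
      hence "(2::int) ^ (n - 2) dvd 1" by (metis dvd_triv_left of_nat_numeral of_nat_power)
      thus False using pow_bound(2)[OF assms] by (auto dest: zdvd_imp_le)
    qed
    ultimately show "D_pow n (2 ^ (n - 2)) \<noteq> carrier (grp n (F n))" by auto
  qed
  moreover have sub_SE: "subgroup (sqrt_F n \<inter> E n) (U n)"
    using sub_S sub_E by (rule FB.subgroups_Inter_pair)
  moreover have "subgroup (F n) (grp n (sqrt_F n \<inter> E n))"
    using sub_F sub_SE by (rule FB.subgroup_incl) (use F_S F_E in blast)
  moreover have "subgroup (sqrt_F n \<inter> E n) (grp n (sqrt_F n))"
    using sub_SE sub_S by (rule FB.subgroup_incl) blast
  \<comment> \<open>the square of \<open>d n 1\<close> is not in \<open>F n\<close>, as \<open>2^(n-2)\<close> does not divide \<open>2\<close>\<close>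
  moreover have "sqrt_F n \<noteq> D n"
  proof
    have i: "None \<in> basis_index n" by (simp add: basis_index_def)
    assume "sqrt_F n = D n"
    hence "d n 1 ^ 2 \<in> F n"
      using basis_elt_in_D[OF assms i] by (auto simp: sqrt_F_def FB.nat_pow_eq)
    hence "power_prod (basis_index n) (basis_elt n) (\<lambda>i'. if i' = None then 2 else 0) \<in> FB.power_span"
      unfolding F power_prod_single[OF FB.fin i] by simp
    hence "int (FB.span_exp None) dvd 2" unfolding FB.mem_power_span_iff using i by fastforce
    hence "(2::int) ^ (n - 2) dvd 2" using e[OF i] by simp
    thus False using pow_bound(2)[OF assms] by (auto dest: zdvd_imp_le)
  qed
  ultimately show ?thesis by (simp add: proper_subgroup_def)
qed

end
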